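(* Let $(V,G)$ be an orthogonal representation of a compact Lie group $G$ with nontrivial copolarity, let $\Sigma\subseteq V$ be a fat section of $(V,G)$, and let $\sigma:V\to\Sigma$ be the orthogonal projection. Let $E\subset V$ be a $G$-invariant compact convex set in $V$ and let $P:=\sigma(E)=E\cap\Sigma$, a convex set in $\Sigma$. Then the faces of $E$ are exposed if and only if the faces of $P$ are exposed.
   Context: An orthogonal representation $(V,G)$ of a compact Lie group $G$ is a continuous homomorphism $G\to O(V)$, where $V$ is a finite-dimensional real vector space with scalar product $\langle\cdot,\cdot\rangle$. A point $p\in V$ is $G$-regular if it lies on a principal orbit. $T_p(G\cdot p)$ denotes the tangent space of the orbit at $p$, and $\nu_p(G\cdot p)$ its orthogonal complement in $V$ (the normal space). A fat section of $(V,G)$ is a subset $\Sigma\subseteq V$ such that: (A) $\Sigma$ is a linear subspace of $V$ that intersects all $G$-orbits; (B) for all $G$-regular $p\in\Sigma$ we have $\nu_p(G\cdot p)\subseteq T_p\Sigma$ with codimension $k$ (for a fixed integer $k\ge 0$); (C) for all $G$-regular $p\in\Sigma$ and all $g\in G$ such that $g\cdot p\in\Sigma$, we have $g\cdot\Sigma=\Sigma$. The whole space $V$ is always a fat section; $(V,G)$ has nontrivial copolarity if $V$ is not the unique fat section. It is known (Mendes) that for every $G$-invariant convex set $E\subset V$ one has $\sigma(E)=E\cap\Sigma$, which is a convex subset of $\Sigma$. A face of a compact convex set $C$ is a convex subset $F\subset C$ such that whenever $x,y\in C$ and $\operatorname{relint}[x,y]\cap F\neq\emptyset$, one has $[x,y]\subset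 F$; here $\operatorname{relint}$ denotes the relative interior, i.e. the interior in the affine hull. For a compact convex set $C$ in a Euclidean space $U$, every nonzero vector $u\in U$ defines an exposed face $F_u(C):=\{x\in C\mid\langle x,u\rangle=\max_{y\in C}\langle y,u\rangle\}$; a face of $C$ is exposed if it is of this form. For $E$ one takes $U=V$, and for $P$ one takes $U=\Sigma$. *)

theory Defs
  imports "HOL-Analysis.Analysis" "HOL-Algebra.Group_Action"
begin

section \<open>Smooth maps and compact Lie groups\<close>

text \<open>\<open>Ck_on k S f\<close> is meant for open \<open>S\<close>: a map is of class \<open>C^(k+1)\<close> iff it is differentiable and
  all its directional derivatives are of class \<open>C^k\<close>.\<close>

primrec Ck_on ::
  "nat \<Rightarrow> 'a::euclidean_space set \<Rightarrow> ('a \<Rightarrow> 'b::euclidean_space) \<Rightarrow> bool" where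
  "Ck_on 0 S f \<longleftrightarrow> continuous_on S f"
| "Ck_on (Suc k) S f \<longleftrightarrow>
     (\<forall>x\<in>S. f differentiable (at x)) \<and>
     (\<forall>v. Ck_on k S (\<lambda>x. frechet_derivative f (at x) v))"

text \<open>Smoothness on an arbitrary subset of a Euclidean space is local extendability to a smooth
  map on an open set. On open sets this is the usual notion, and on relatively open subsets
  of a linear subspace it is smoothness in the sense of that subspace.\<close>

definition smooth_on ::
  "'a::euclidean_space set \<Rightarrow> ('a \<Rightarrow> 'b::euclidean_space) \<Rightarrow> bool" where
  "smooth_on S f \<longleftrightarrow>
     (\<forall>x\<in>S. \<exists>N h. open N \<and> x \<in> N \<and> (\<forall>k. Ck_on k N h) \<and> (\<forall>y\<in>S \<inter> N. h y = f y))"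

text \<open>Charts are pairs of a domain and a map. The model space is a linear subspace \<open>W\<close> of a type
  of class \<open>euclidean_space\<close>, and not the whole type: such a type has positive dimension, but finite
  groups (dimension 0) have to be covered.\<close>

definition smooth_atlas ::
  "'g topology \<Rightarrow> ('g set \<times> ('g \<Rightarrow> 'e::euclidean_space)) set \<Rightarrow> bool" where
  "smooth_atlas T A \<longleftrightarrow>
     (\<exists>W. subspace W \<and>
        (\<forall>(U, c)\<in>A. openin T U \<and> openin (top_of_set W) (c ` U) \<and>
           homeomorphic_map (subtopology T U) (top_of_set (c ` U)) c)) \<and>
     (\<Union>(U, c)\<in>A. U) = topspace T \<and>
     (\<forall>(U, c)\<in>A. \<forall>(U', c')\<in>A. smooth_on (c ` (U \<inter> U')) (c' \<circ> inv_into U c))"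

definition topological_group :: "('g, 'm) monoid_scheme \<Rightarrow> 'g topology \<Rightarrow> bool" where
  "topological_group G T \<longleftrightarrow>
     group G \<and> topspace T = carrier G \<and>
     continuous_map (prod_topology T T) T (\<lambda>(g, h). g \<otimes>\<^bsub>G\<^esub> h) \<and>
     continuous_map T T (\<lambda>g. inv\<^bsub>G\<^esub> g)"

definition lie_group ::
  "('g, 'm) monoid_scheme \<Rightarrow> 'g topology \<Rightarrow> ('g set \<times> ('g \<Rightarrow> 'e::euclidean_space)) set \<Rightarrow> bool"
  where
  "lie_group G T A \<longleftrightarrow>
     topological_group G T \<and> Hausdorff_space T \<and> second_countable T \<and> smooth_atlas T A \<and>
     (\<forall>(U, c)\<in>A. \<forall>(U', c')\<in>A. \<forall>(U'', c'')\<in>A.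
        smooth_on {(c g, c' h) | g h. g \<in> U \<and> h \<in> U' \<and> g \<otimes>\<^bsub>G\<^esub> h \<in> U''}
          (\<lambda>(a, b). c'' (inv_into U c a \<otimes>\<^bsub>G\<^esub> inv_into U' c' b))) \<and>
     (\<forall>(U, c)\<in>A. \<forall>(U', c')\<in>A.
        smooth_on {c g | g. g \<in> U \<and> inv\<^bsub>G\<^esub> g \<in> U'}
          (\<lambda>a. c' (inv\<^bsub>G\<^esub> (inv_into U c a))))"

definition compact_lie_group ::
  "('g, 'm) monoid_scheme \<Rightarrow> 'g topology \<Rightarrow> ('g set \<times> ('g \<Rightarrow> 'e::euclidean_space)) set \<Rightarrow> bool"
  where
  "compact_lie_group G T A \<longleftrightarrow> lie_group G T A \<and> compact_space T"


section \<open>Orthogonal representations\<close>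

text \<open>\<open>O(V)\<close>, with the topology of the operator norm.\<close>

definition orthogonal_group :: "('v::euclidean_space \<Rightarrow>\<^sub>L 'v) monoid" where
  "orthogonal_group =
     \<lparr>carrier = {f. orthogonal_transformation (blinfun_apply f)}, mult = (o\<^sub>L), one = id_blinfun\<rparr>"

definition orthogonal_representation ::
  "('g, 'm) monoid_scheme \<Rightarrow> 'g topology \<Rightarrow> ('g \<Rightarrow> 'v::euclidean_space \<Rightarrow>\<^sub>L 'v) \<Rightarrow> bool" where
  "orthogonal_representation G T \<rho> \<longleftrightarrow>
     \<rho> \<in> hom G orthogonal_group \<and>
     continuous_map T (top_of_set (carrier orthogonal_group)) \<rho>"

abbreviation rep_orbit ::
  "('g, 'm) monoid_scheme \<Rightarrow> ('g \<Rightarrow> 'v::euclidean_space \<Rightarrow>\<^sub>L 'v) \<Rightarrow> 'v \<Rightarrow> 'v set" where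
  "rep_orbit G \<rho> p \<equiv> orbit G (\<lambda>g. blinfun_apply (\<rho> g)) p"

abbreviation rep_stabilizer ::
  "('g, 'm) monoid_scheme \<Rightarrow> ('g \<Rightarrow> 'v::euclidean_space \<Rightarrow>\<^sub>L 'v) \<Rightarrow> 'v \<Rightarrow> 'g set" where
  "rep_stabilizer G \<rho> p \<equiv> stabilizer G (\<lambda>g. blinfun_apply (\<rho> g)) p"

text \<open>The orbit of \<open>p\<close> is principal if every \<open>q\<close> near \<open>p\<close> has a point \<open>g \<cdot> q\<close> on its orbit whose
  stabilizer (a conjugate of that of \<open>q\<close>) contains the stabilizer of \<open>p\<close>. As \<open>V\<close> is connected, by
  the principal orbit theorem this singles out the orbits of the maximal orbit type.\<close>

definition regular_point ::
  "('g, 'm) monoid_scheme \<Rightarrow> ('g \<Rightarrow> 'v::euclidean_space \<Rightarrow>\<^sub>L 'v) \<Rightarrow> 'v \<Rightarrow> bool" where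
  "regular_point G \<rho> p \<longleftrightarrow>
     (\<exists>N. open N \<and> p \<in> N \<and>
        (\<forall>q\<in>N. \<exists>g\<in>carrier G. rep_stabilizer G \<rho> p \<subseteq> rep_stabilizer G \<rho> (\<rho> g q)))"

text \<open>For an embedded submanifold \<open>M\<close> this is the tangent space at \<open>p\<close>, viewed as a linear
  subspace of the ambient space. Orbits of compact Lie groups are embedded.\<close>

definition tangent_space :: "'v::euclidean_space set \<Rightarrow> 'v \<Rightarrow> 'v set" where
  "tangent_space M p =
     {v. \<exists>\<gamma> e. e > (0::real) \<and> smooth_on {-e<..<e} \<gamma> \<and> \<gamma> ` {-e<..<e} \<subseteq> M \<and>
         \<gamma> 0 = p \<and> (\<gamma> has_vector_derivative v) (at 0)}"

abbreviation normal_space :: "'v::euclidean_space set \<Rightarrow> 'v \<Rightarrow> 'v set" where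
  "normal_space M p \<equiv> (tangent_space M p)\<^sup>\<bottom>"

definition fat_section ::
  "('g, 'm) monoid_scheme \<Rightarrow> ('g \<Rightarrow> 'v::euclidean_space \<Rightarrow>\<^sub>L 'v) \<Rightarrow> 'v set \<Rightarrow> bool" where
  "fat_section G \<rho> S \<longleftrightarrow>
     subspace S \<and>
     (\<forall>x. rep_orbit G \<rho> x \<inter> S \<noteq> {}) \<and>
     (\<exists>k. \<forall>p\<in>S. regular_point G \<rho> p \<longrightarrow>
        normal_space (rep_orbit G \<rho> p) p \<subseteq> tangent_space S p \<and>
        dim (tangent_space S p) = dim (normal_space (rep_orbit G \<rho> p) p) + k) \<and>
     (\<forall>p\<in>S. regular_point G \<rho> p \<longrightarrow>
        (\<forall>g\<in>carrier G. \<rho> g p \<in> S \<longrightarrow> \<rho> g ` S = S))"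

definition nontrivial_copolarity ::
  "('g, 'm) monoid_scheme \<Rightarrow> ('g \<Rightarrow> 'v::euclidean_space \<Rightarrow>\<^sub>L 'v) \<Rightarrow> bool" where
  "nontrivial_copolarity G \<rho> \<longleftrightarrow> {S. fat_section G \<rho> S} \<noteq> {UNIV}"

definition invariant_set ::
  "('g, 'm) monoid_scheme \<Rightarrow> ('g \<Rightarrow> 'v::euclidean_space \<Rightarrow>\<^sub>L 'v) \<Rightarrow> 'v set \<Rightarrow> bool" where
  "invariant_set G \<rho> E \<longleftrightarrow> (\<forall>g\<in>carrier G. \<rho> g ` E \<subseteq> E)"

definition orthogonal_projection :: "'v::euclidean_space set \<Rightarrow> ('v \<Rightarrow> 'v) \<Rightarrow> bool" where
  "orthogonal_projection S \<sigma> \<longleftrightarrow> (\<forall>x. \<sigma> x \<in> S \<and> x - \<sigma> x \<in> S\<^sup>\<bottom>)"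


section \<open>Exposed faces\<close>

definition exposed_face :: "'v::euclidean_space set \<Rightarrow> 'v \<Rightarrow> 'v set" where
  "exposed_face C u = {x \<in> C. \<forall>y\<in>C. y \<bullet> u \<le> x \<bullet> u}"

text \<open>All faces of \<open>C\<close> are exposed, by nonzero vectors of the space \<open>U\<close> in which \<open>C\<close> is
  considered. As usual this is about nonempty proper faces: the empty face is never of the form
  \<open>exposed_face C u\<close> when \<open>C\<close> is compact and nonempty, and \<open>C\<close> itself is of this form with \<open>u\<close>
  nonzero only when it lies in an affine hyperplane of \<open>U\<close>.\<close>

definition faces_exposed :: "'v::euclidean_space set \<Rightarrow> 'v set \<Rightarrow> bool" where
  "faces_exposed U C \<longleftrightarrow>
     (\<forall>F. F face_of C \<and> F \<noteq> {} \<and> F \<noteq> C \<longrightarrow> (\<exists>u\<in>U. u \<noteq> 0 \<and> F = exposed_face C u))"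

end

theory Submission
  imports Defs
begin

text \<open>The image \<open>K\<close> of \<open>G\<close> in \<open>O(V)\<close> is a compact group, and everything below is about \<open>K\<close>. Two facts
about the section \<open>S\<close> carry the proof.

Maximisers can be moved into the section (\<open>maximizer_isotropy_orbit_meets\<close>): if \<open>u \<in> S\<close> and \<open>x\<close>
maximises \<open>\<langle>\<cdot>, u\<rangle>\<close> on its orbit, then some \<open>g \<in> K\<close> fixing \<open>u\<close> takes \<open>x\<close> into \<open>S\<close>. For principal \<open>u\<close>
this holds with \<open>g = 1\<close>, because \<open>x\<close> is then normal to the orbit of \<open>u\<close> and normal vectors lie in
\<open>S\<close>. The general case is a limit of this one; the tilted point \<open>x + u\<close> replaces \<open>x\<close>, so that the limit
of the maximising group elements is forced to fix \<open>u\<close>. Comparing support functions,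
\<open>\<sigma>(E) = E \<inter> S\<close> follows (\<open>projection_eq_section\<close>).

The limit argument needs that principal points are dense in \<open>S\<close> (\<open>principal_dense_in_section\<close>).
At a principal point \<open>p \<in> S\<close> the infinitesimal motions of \<open>p\<close> together with \<open>S\<close> span \<open>V\<close>. This
transversality is an algebraic condition, so it holds at points of \<open>S\<close> arbitrarily
close to any given one. Near a transversal point the orbit of \<open>S\<close> fills a neighbourhood, which contains
principal points of \<open>V\<close>; so there are principal points of \<open>S\<close> nearby. The infinitesimal
motions are the elements of the tangent cone of \<open>K\<close> at the identity, and the points sought near a
transversal point are found by minimisation over compact sets (\<open>penalised_nearest_point\<close>).

Now to faces. If the faces of \<open>E\<close> are exposed and \<open>F'\<close> is a face of \<open>P = E \<inter> S\<close>, let \<open>F\<close> be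
the face of \<open>E\<close> with a relative interior point of \<open>F'\<close> in its own relative interior. Then \<open>F' = F \<inter> S\<close>,
and a vector \<open>u\<close> exposing \<open>F\<close> can be replaced by \<open>\<sigma>(u)\<close>. Conversely let the faces of \<open>P\<close> be
exposed and let \<open>F\<close> be a proper face of \<open>E\<close>, moved by \<open>K\<close> so that its relative interior meets \<open>S\<close>. Let
\<open>u \<in> S\<close> expose \<open>F \<inter> S\<close> in \<open>P\<close>. Then \<open>F\<close> is a face of \<open>F\<^sub>u(E)\<close>, which is invariant under the isotropy group
of \<open>u\<close>. A point of \<open>F\<^sub>u(E)\<close> fixed by this group lies in \<open>S\<close> by the first fact, hence in
\<open>F\<^sub>u(P) = F \<inter> S\<close>. But a face of an invariant convex set containing all the fixed points is the whole set
(\<open>face_containing_fixed_points\<close>): every orbit has a fixed point in its convex hull, and it is a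
convex combination in which any prescribed point of the orbit has a positive coefficient. So
\<open>F = F\<^sub>u(E)\<close>.\<close>

section \<open>Faces, and a lemma on linear pencils\<close>

lemma face_of_contains_summand:
  fixes F :: "'a::real_vector set"
  assumes F: "F face_of C" and C: "convex C" and T: "finite T"
    and a: "\<And>i. i \<in> T \<Longrightarrow> a i \<ge> 0" "sum a T = 1"
    and w: "\<And>i. i \<in> T \<Longrightarrow> w i \<in> C" and sum: "(\<Sum>i\<in>T. a i *\<^sub>R w i) \<in> F"
    and j: "j \<in> T" "a j > 0"
  shows "w j \<in> F"
proof -
  have split_a: "sum a (T - {j}) = 1 - a j"
    using sum.remove[OF T j(1), of a] a(2) by simp
  have split_w: "(\<Sum>i\<in>T. a i *\<^sub>R w i) = a j *\<^sub>R w j + (\<Sum>i\<in>T - {j}. a i *\<^sub>R w i)"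
    by (rule sum.remove[OF T j(1)])
  have a_pos: "0 \<le> sum a (T - {j})" using a(1) by (intro sum_nonneg) auto
  show ?thesis
  proof (cases "a j = 1")
    case True
    then have "\<forall>i\<in>T - {j}. a i = 0"
      using split_a sum_nonneg_eq_0_iff[of "T - {j}" a] T a(1) by simp
    then have "(\<Sum>i\<in>T. a i *\<^sub>R w i) = w j" unfolding split_w True by simp
    then show ?thesis using sum by simp
  next
    case False
    then have lt: "a j < 1" using split_a a_pos by linarith
    define z where "z = (\<Sum>i\<in>T - {j}. (a i / (1 - a j)) *\<^sub>R w i)"
    have "z \<in> C" unfolding z_def
    proof (rule convex_sum)
      show "(\<Sum>i\<in>T - {j}. a i / (1 - a j)) = 1"
        using split_a lt by (simp flip: sum_divide_distrib)
    qed (use T C a(1) w lt in auto)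
    have c: "(\<Sum>i\<in>T. a i *\<^sub>R w i) = (1 - a j) *\<^sub>R z + a j *\<^sub>R w j"
      unfolding split_w z_def scaleR_right.sum using lt by simp
    show ?thesis
    proof (cases "z = w j")
      case True
      then have "(\<Sum>i\<in>T. a i *\<^sub>R w i) = w j" using c by (simp flip: scaleR_left_distrib)
      then show ?thesis using sum by simp
    next
      case False
      then have "(\<Sum>i\<in>T. a i *\<^sub>R w i) \<in> open_segment z (w j)"
        unfolding c in_segment using j(2) lt by blast
      then show ?thesis using face_ofD[OF F _ \<open>z \<in> C\<close> w[OF j(1)] sum] by blast
    qed
  qed
qed

text \<open>The smallest face through \<open>z\<close> does it: were \<open>z\<close> on its relative boundary, a supporting
hyperplane at \<open>z\<close> would cut out a smaller one.\<close>

lemma face_with_point_in_rel_interior: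
  fixes C :: "'a::euclidean_space set"
  assumes C: "convex C" and z: "z \<in> C"
  obtains F where "F face_of C" "z \<in> rel_interior F"
proof -
  define \<F> where "\<F> = {T. T face_of C \<and> z \<in> T}"
  have "C \<in> \<F>" using C z by (simp add: \<F>_def face_of_refl)
  then have F: "\<Inter>\<F> face_of C" by (intro face_of_Inter) (auto simp: \<F>_def)
  have zF: "z \<in> \<Inter>\<F>" by (simp add: \<F>_def)
  have convF: "convex (\<Inter>\<F>)" by (rule face_of_imp_convex[OF F])
  have "z \<in> rel_interior (\<Inter>\<F>)"
  proof (rule ccontr)
    assume "z \<notin> rel_interior (\<Inter>\<F>)"
    then obtain a where a: "\<And>y. y \<in> \<Inter>\<F> \<Longrightarrow> a \<bullet> z \<le> a \<bullet> y"
      "\<And>y. y \<in> rel_interior (\<Inter>\<F>) \<Longrightarrow> a \<bullet> z < a \<bullet> y"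
      using supporting_hyperplane_rel_boundary[OF convF zF] by metis
    define T where "T = \<Inter>\<F> \<inter> {y. a \<bullet> y = a \<bullet> z}"
    have "T face_of \<Inter>\<F>"
      unfolding T_def by (rule face_of_Int_supporting_hyperplane_ge[OF convF a(1)])
    then have "T face_of C" using F by (rule face_of_trans)
    moreover have "z \<in> T" using zF by (simp add: T_def)
    ultimately have "\<Inter>\<F> \<subseteq> T" by (auto simp: \<F>_def)
    moreover obtain y where "y \<in> rel_interior (\<Inter>\<F>)"
      using rel_interior_eq_empty[OF convF] zF by blast
    ultimately show False
      using a(2)[of y] rel_interior_subset[of "\<Inter>\<F>"] unfolding T_def by fastforce
  qed
  with F that show ?thesis by blast
qed

lemma exposed_face_is_face:
  fixes C :: "'a::euclidean_space set"
  assumes "convex C" "z \<in> exposed_face C u"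
  shows "exposed_face C u face_of C"
proof -
  have "exposed_face C u = C \<inter> {x. u \<bullet> x = u \<bullet> z}"
    using assms(2) unfolding exposed_face_def inner_commute[of u] by force
  moreover have "(C \<inter> {x. u \<bullet> x = u \<bullet> z}) face_of C"
    using assms by (intro face_of_Int_supporting_hyperplane_le)
      (auto simp: exposed_face_def inner_commute)
  ultimately show ?thesis by simp
qed

lemma eq_of_inner_ge:
  fixes x y :: "'a::real_inner"
  assumes "norm x = norm y" "x \<bullet> y \<ge> y \<bullet> y"
  shows "x = y"
proof -
  have "(x - y) \<bullet> (x - y) = x \<bullet> x - 2 * (x \<bullet> y) + y \<bullet> y"
    by (simp add: inner_diff_left inner_diff_right inner_commute)
  moreover have "x \<bullet> x = y \<bullet> y" using assms(1) by (metis dot_square_norm)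
  ultimately have "(x - y) \<bullet> (x - y) \<le> 0" using assms(2) by linarith
  then have "x - y = 0" by (metis inner_gt_zero_iff linorder_not_less)
  then show ?thesis by simp
qed

text \<open>Eigenvectors for distinct eigenvalues are independent, in a form for pencils: \<open>f\<close> and \<open>g\<close> are the
coordinates of two linear maps on \<open>N\<close>, with index set \<open>L\<close>, and \<open>g\<close> is injective. As in the classical
proof, applying \<open>f - \<mu>\<^sub>j g\<close> to a vanishing sum removes the term with index \<open>j\<close>.\<close>

lemma distinct_ratios_imp_independent:
  fixes f g :: "'c \<Rightarrow> 'a::real_vector \<Rightarrow> real"
  assumes lin: "\<And>X. X \<in> L \<Longrightarrow> linear (f X)" "\<And>X. X \<in> L \<Longrightarrow> linear (g X)"
    and nondeg: "\<And>\<xi>. \<xi> \<in> N \<Longrightarrow> (\<And>X. X \<in> L \<Longrightarrow> g X \<xi> = 0) \<Longrightarrow> \<xi> = 0"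
    and "subspace N" "finite I" "inj_on \<mu> I"
    and "\<And>i. i \<in> I \<Longrightarrow> w i \<in> N"
    and "\<And>i X. i \<in> I \<Longrightarrow> X \<in> L \<Longrightarrow> f X (w i) = \<mu> i * g X (w i)"
    and "(\<Sum>i\<in>I. w i) = 0" and "i \<in> I"
  shows "w i = 0"
  using assms(5-)
proof (induction I arbitrary: w i rule: finite_induct)
  case (insert j I)
  define w' where "w' i = (\<mu> i - \<mu> j) *\<^sub>R w i" for i
  have zero: "g X (\<Sum>i\<in>I. w' i) = 0" if X: "X \<in> L" for X
  proof -
    have "0 = f X (\<Sum>i\<in>insert j I. w i)" using insert.prems(4) linear_0[OF lin(1)[OF X]] by simp
    also have "\<dots> = (\<Sum>i\<in>insert j I. \<mu> i * g X (w i))"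
      unfolding linear_sum[OF lin(1)[OF X]] using insert.prems(3) X by (intro sum.cong) auto
    finally have 1: "(\<Sum>i\<in>insert j I. \<mu> i * g X (w i)) = 0" by simp
    have "0 = g X (\<Sum>i\<in>insert j I. w i)" using insert.prems(4) linear_0[OF lin(2)[OF X]] by simp
    then have 2: "(\<Sum>i\<in>insert j I. g X (w i)) = 0"
      unfolding linear_sum[OF lin(2)[OF X]] by simp
    have "g X (\<Sum>i\<in>I. w' i) = (\<Sum>i\<in>I. (\<mu> i - \<mu> j) * g X (w i))"
      unfolding linear_sum[OF lin(2)[OF X]] w'_def linear_cmul[OF lin(2)[OF X]] by simp
    also have "\<dots> = (\<Sum>i\<in>insert j I. (\<mu> i - \<mu> j) * g X (w i))"
      using insert.hyps by simp
    also have "\<dots> = (\<Sum>i\<in>insert j I. \<mu> i * g X (w i)) - \<mu> j * (\<Sum>i\<in>insert j I. g X (w i))"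
      unfolding sum_distrib_left sum_subtractf[symmetric] by (simp add: left_diff_distrib)
    finally show ?thesis using 1 2 by simp
  qed
  have w'N: "w' i \<in> N" if "i \<in> I" for i
    using insert.prems(2) that \<open>subspace N\<close> by (simp add: w'_def subspace_scale)
  have sum0: "(\<Sum>i\<in>I. w' i) = 0"
    by (rule nondeg[OF subspace_sum[OF \<open>subspace N\<close> w'N] zero])
  have eq: "f X (w' i) = \<mu> i * g X (w' i)" if "i \<in> I" "X \<in> L" for i X
    using insert.prems(3)[of i X] that
    by (simp add: w'_def linear_cmul[OF lin(1)] linear_cmul[OF lin(2)])
  have inj: "inj_on \<mu> I" using insert.prems(1) by (simp add: inj_on_insert)
  have w0: "w i = 0" if "i \<in> I" for i
  proof -
    have "w' i = 0" by (rule insert.IH[OF inj w'N eq sum0 that])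
    moreover have "\<mu> i \<noteq> \<mu> j"
      using insert.prems(1) insert.hyps(2) that by (auto simp: inj_on_def)
    ultimately show ?thesis by (simp add: w'_def)
  qed
  have "w j = 0" using insert.prems(4) insert.hyps w0 by simp
  then show ?case using insert.prems(5) w0 by blast
qed simp

section \<open>Compact groups of orthogonal maps and principal points\<close>

locale compact_orthogonal_group =
  fixes K :: "('v::euclidean_space \<Rightarrow>\<^sub>L 'v) set"
  assumes compact_K: "compact K"
    and orthogonal_K: "g \<in> K \<Longrightarrow> orthogonal_transformation (blinfun_apply g)"
    and id_K: "id_blinfun \<in> K"
    and compose_K: "g \<in> K \<Longrightarrow> h \<in> K \<Longrightarrow> g o\<^sub>L h \<in> K"
    and inverse_K: "g \<in> K \<Longrightarrow> \<exists>h\<in>K. h o\<^sub>L g = id_blinfun \<and> g o\<^sub>L h = id_blinfun"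
begin

lemma inner_K: "g \<in> K \<Longrightarrow> g x \<bullet> g y = x \<bullet> y"
  using orthogonal_K by (auto simp: orthogonal_transformation_def)

lemma norm_K: "g \<in> K \<Longrightarrow> norm (g x) = norm x"
  by (simp add: inner_K norm_eq_sqrt_inner)

lemma inverse_K_apply:
  assumes "g \<in> K"
  obtains h where "h \<in> K" "\<And>x. h (g x) = x" "\<And>x. g (h x) = x"
    "\<And>x y. g x \<bullet> y = x \<bullet> h y" "h o\<^sub>L g = id_blinfun" "g o\<^sub>L h = id_blinfun"
proof -
  obtain h where h: "h \<in> K" "h o\<^sub>L g = id_blinfun" "g o\<^sub>L h = id_blinfun"
    using inverse_K[OF assms] by blast
  have 1: "h (g x) = x" "g (h x) = x" for x
    using h(2,3) by (metis blinfun_apply_blinfun_compose blinfun_apply_id_blinfun id_apply)+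
  have "g x \<bullet> y = x \<bullet> h y" for x y
    using inner_K[OF assms, of x "h y"] by (simp add: 1)
  with h 1 that show ?thesis by blast
qed

lemma norm_blinfun_K: "g \<in> K \<Longrightarrow> norm g \<le> 1"
  by (rule norm_blinfun_bound) (simp_all add: norm_K)

lemma norm_compose_K: "g \<in> K \<Longrightarrow> norm (g o\<^sub>L X) \<le> norm X"
  using norm_blinfun_compose[of g X] norm_blinfun_K[of g]
  by (meson mult_left_le_one_le norm_ge_zero order_trans)

lemma norm_compose_right_K: "g \<in> K \<Longrightarrow> norm (X o\<^sub>L g) \<le> norm X"
  using norm_blinfun_compose[of X g] norm_blinfun_K[of g]
  by (meson mult_right_le_one_le norm_ge_zero order_trans)

definition orb :: "'v \<Rightarrow> 'v set" where
  "orb x = (\<lambda>g. blinfun_apply g x) ` K"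

lemma compact_orb: "compact (orb x)"
  unfolding orb_def
  by (intro compact_continuous_image compact_K continuous_intros)

lemma maximum_on_orbit: "\<exists>g\<in>K. \<forall>h\<in>K. h x \<bullet> u \<le> g x \<bullet> u"
proof -
  have "continuous_on K (\<lambda>g. blinfun_apply g x \<bullet> u)"
    by (intro continuous_intros)
  then show ?thesis
    using continuous_attains_sup[OF compact_K, of "\<lambda>g. blinfun_apply g x \<bullet> u"] id_K by blast
qed

definition isotropy :: "'v \<Rightarrow> ('v \<Rightarrow>\<^sub>L 'v) set" where
  "isotropy x = {g \<in> K. g x = x}"

definition fixed_space :: "('v \<Rightarrow>\<^sub>L 'v) set \<Rightarrow> 'v set" where
  "fixed_space H = {x. \<forall>g\<in>H. g x = x}"

lemma subspace_fixed_space: "subspace (fixed_space H)"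
  by (auto simp: fixed_space_def subspace_def blinfun.bilinear_simps)

text \<open>Tilting \<open>x\<close> towards \<open>u\<close> makes the maximum sharp. If \<open>x\<close> maximises \<open>\<langle>\<cdot>, u\<rangle>\<close> on its orbit, then on
the orbit of \<open>x + s u\<close> both summands are maximal at the identity, and \<open>\<langle>g u, u\<rangle> = \<langle>u, u\<rangle>\<close> forces
\<open>g u = u\<close>. Geometrically, the point \<open>u\<close> of an orbit that is nearest to \<open>x\<close> is the only nearest one for
points strictly between \<open>u\<close> and \<open>x\<close>.\<close>

lemma tilted_maximum_fixes:
  assumes g: "g \<in> K" and max: "g x \<bullet> u \<le> x \<bullet> u" and "s > 0"
    and ge: "g (x + s *\<^sub>R u) \<bullet> u \<ge> (x + s *\<^sub>R u) \<bullet> u"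
  shows "g u = u"
proof -
  have "s * (g u \<bullet> u) \<ge> s * (u \<bullet> u)"
    using max ge by (simp add: blinfun.bilinear_simps inner_add_left)
  then have "g u \<bullet> u \<ge> u \<bullet> u" using \<open>s > 0\<close> by simp
  then show ?thesis using eq_of_inner_ge[OF norm_K[OF g]] by blast
qed

lemma isotropy_of_tilted_maximum:
  assumes "\<And>h. h \<in> K \<Longrightarrow> h x \<bullet> u \<le> x \<bullet> u" and "s > 0"
  shows "isotropy (x + s *\<^sub>R u) \<subseteq> isotropy u \<inter> isotropy x"
proof
  fix g assume "g \<in> isotropy (x + s *\<^sub>R u)"
  then have g: "g \<in> K" "g (x + s *\<^sub>R u) = x + s *\<^sub>R u" by (auto simp: isotropy_def)
  then have "g u = u" using tilted_maximum_fixes[OF g(1) assms(1)[OF g(1)] \<open>s > 0\<close>] by simp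
  then show "g \<in> isotropy u \<inter> isotropy x"
    using g by (auto simp: isotropy_def blinfun.bilinear_simps)
qed

text \<open>The fixed space grows as the isotropy group shrinks, and its dimension attains a maximum. So this says that
the isotropy group is as small as possible, measured by a bounded integer.\<close>

definition principal :: "'v \<Rightarrow> bool" where
  "principal p \<longleftrightarrow> (\<forall>q. dim (fixed_space (isotropy q)) \<le> dim (fixed_space (isotropy p)))"

lemma principal_exists: "\<exists>p. principal p"
proof -
  let ?d = "\<lambda>q. dim (fixed_space (isotropy q))"
  have "\<exists>p. \<forall>q. ?d q \<le> ?d p"
    by (rule ex_has_greatest_nat[where P="\<lambda>_. True" and b="Suc DIM('v)", simplified])
       (simp add: dim_subset_UNIV le_imp_less_Suc)
  then show ?thesis by (simp add: principal_def)
qed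

lemma fixed_space_anti: "H \<subseteq> H' \<Longrightarrow> fixed_space H' \<subseteq> fixed_space H"
  by (auto simp: fixed_space_def)

lemma principal_isotropy_subset:
  assumes "principal p" and "isotropy q \<subseteq> isotropy p"
  shows "principal q" and "fixed_space (isotropy q) = fixed_space (isotropy p)"
proof -
  have sub: "fixed_space (isotropy p) \<subseteq> fixed_space (isotropy q)"
    by (rule fixed_space_anti) fact
  have le: "dim (fixed_space (isotropy q)) \<le> dim (fixed_space (isotropy p))"
    using assms(1) by (simp add: principal_def)
  have eq: "fixed_space (isotropy p) = fixed_space (isotropy q)"
    by (rule subspace_dim_equal[OF subspace_fixed_space subspace_fixed_space sub le])
  then show "fixed_space (isotropy q) = fixed_space (isotropy p)" by simp
  show "principal q" using assms(1) eq by (simp add: principal_def)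
qed

lemma principal_apply:
  assumes p: "principal p" and g: "g \<in> K"
  shows "principal (g p)"
proof -
  obtain h where h: "h \<in> K" "\<And>x. h (g x) = x" "\<And>x. g (h x) = x"
    by (rule inverse_K_apply[OF g]) blast
  have "g ` fixed_space (isotropy p) \<subseteq> fixed_space (isotropy (g p))"
  proof clarsimp
    fix v assume v: "v \<in> fixed_space (isotropy p)"
    show "g v \<in> fixed_space (isotropy (g p))"
      unfolding fixed_space_def
    proof clarsimp
      fix k assume "k \<in> isotropy (g p)"
      then have k: "k \<in> K" "k (g p) = g p" by (auto simp: isotropy_def)
      have "h o\<^sub>L (k o\<^sub>L g) \<in> isotropy p"
        using k h g by (auto simp: isotropy_def intro!: compose_K)
      then have "h (k (g v)) = v" using v by (auto simp: fixed_space_def)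
      then show "k (g v) = g v" by (metis h(3))
    qed
  qed
  then have "dim (g ` fixed_space (isotropy p)) \<le> dim (fixed_space (isotropy (g p)))"
    by (rule dim_subset)
  moreover have "dim (g ` fixed_space (isotropy p)) = dim (fixed_space (isotropy p))"
    by (intro dim_image_eq inj_on_inverseI[where g=h] h)
       (rule bounded_linear.linear, rule blinfun.bounded_linear_right)
  ultimately show ?thesis using p unfolding principal_def by (metis order_trans)
qed

text \<open>So principal points are regular, with the whole space as neighbourhood. Choose \<open>g y\<close> in the orbit of \<open>y\<close> as
near to \<open>p\<close> as possible. The isotropy group of \<open>g y + p\<close> fixes both \<open>p\<close> and \<open>g y\<close>. Its fixed space contains
that of \<open>isotropy p\<close>, so by maximality they are equal, and \<open>g y\<close> is fixed by \<open>isotropy p\<close>.\<close>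

lemma principal_isotropy_fixes:
  assumes "principal p"
  shows "\<exists>g\<in>K. isotropy p \<subseteq> isotropy (g y)"
proof -
  obtain g where g: "g \<in> K" "\<And>h. h \<in> K \<Longrightarrow> h y \<bullet> p \<le> g y \<bullet> p"
    using maximum_on_orbit by blast
  have max: "h (g y) \<bullet> p \<le> g y \<bullet> p" if "h \<in> K" for h
    using g(2)[OF compose_K[OF that g(1)]] by simp
  have sub: "isotropy (g y + 1 *\<^sub>R p) \<subseteq> isotropy p \<inter> isotropy (g y)"
    by (rule isotropy_of_tilted_maximum[OF max]) auto
  have "g y \<in> fixed_space (isotropy (g y + 1 *\<^sub>R p))"
    using sub by (auto simp: fixed_space_def isotropy_def)
  then have "g y \<in> fixed_space (isotropy p)"
    using principal_isotropy_subset(2)[OF assms] sub by blast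
  then have "isotropy p \<subseteq> isotropy (g y)"
    by (auto simp: fixed_space_def isotropy_def)
  then show ?thesis using g(1) by blast
qed

text \<open>If \<open>g p\<close> is the point nearest to \<open>y\<close> in a principal orbit, then moving \<open>y\<close> slightly towards \<open>g p\<close> shrinks the
isotropy group into that of \<open>g p\<close>.\<close>

lemma principal_dense:
  assumes "e > 0"
  shows "\<exists>q. principal q \<and> dist q y < e"
proof -
  obtain p where p: "principal p" using principal_exists by blast
  obtain g where g: "g \<in> K" "\<And>h. h \<in> K \<Longrightarrow> h p \<bullet> y \<le> g p \<bullet> y"
    using maximum_on_orbit by blast
  have max: "h y \<bullet> g p \<le> y \<bullet> g p" if "h \<in> K" for h
  proof -
    obtain h' where h': "h' \<in> K" "\<And>x y. h x \<bullet> y = x \<bullet> h' y"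
      by (rule inverse_K_apply[OF \<open>h \<in> K\<close>]) blast
    show ?thesis using g(2)[OF compose_K[OF h'(1) g(1)]] h'(2) by (simp add: inner_commute)
  qed
  define s where "s = e / (norm (g p) + 1) / 2"
  have n0: "norm (g p) + 1 > 0" by (smt (verit) norm_ge_zero)
  have s: "s > 0" using n0 \<open>e > 0\<close> by (simp add: s_def)
  have "s * norm (g p) < e"
  proof -
    have "s * norm (g p) \<le> s * (norm (g p) + 1)" using s by simp
    also have "\<dots> = e / 2" using n0 by (simp add: s_def field_simps)
    finally show ?thesis using \<open>e > 0\<close> by linarith
  qed
  then have "dist (y + s *\<^sub>R g p) y < e" using s by (simp add: dist_norm)
  moreover have "principal (y + s *\<^sub>R g p)"
    using principal_isotropy_subset(1)[OF principal_apply[OF p g(1)]] isotropy_of_tilted_maximum[OF max s] by blast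
  ultimately show ?thesis by blast
qed

section \<open>Infinitesimal motions\<close>

definition gpow :: "('v \<Rightarrow>\<^sub>L 'v) \<Rightarrow> nat \<Rightarrow> ('v \<Rightarrow>\<^sub>L 'v)" where
  "gpow g k = (((o\<^sub>L) g) ^^ k) id_blinfun"

lemma gpow_simps [simp]: "gpow g 0 = id_blinfun" "gpow g (Suc k) = g o\<^sub>L gpow g k"
  by (simp_all add: gpow_def)

lemma gpow_K: "g \<in> K \<Longrightarrow> gpow g k \<in> K"
  by (induction k) (simp_all add: id_K compose_K)

lemma norm_gpow_diff:
  assumes "g \<in> K"
  shows "norm (gpow g k - id_blinfun) \<le> real k * norm (g - id_blinfun)"
proof (induction k)
  case (Suc k)
  have "gpow g (Suc k) - id_blinfun = (g o\<^sub>L (gpow g k - id_blinfun)) + (g - id_blinfun)"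
    by (rule blinfun_eqI) (simp add: blinfun.bilinear_simps)
  also have "norm \<dots> \<le> norm (gpow g k - id_blinfun) + norm (g - id_blinfun)"
    by (intro norm_triangle_mono norm_compose_K assms order_refl)
  finally show ?case using Suc by (simp add: algebra_simps)
qed simp

lemma norm_gpow_linear_error:
  assumes "g \<in> K"
  shows "norm (gpow g k - id_blinfun - real k *\<^sub>R (g - id_blinfun))
    \<le> (real k * norm (g - id_blinfun))\<^sup>2"
proof (induction k)
  case (Suc k)
  let ?n = "norm (g - id_blinfun)"
  have "gpow g (Suc k) - id_blinfun - real (Suc k) *\<^sub>R (g - id_blinfun) =
    ((g - id_blinfun) o\<^sub>L (gpow g k - id_blinfun)) +
    (gpow g k - id_blinfun - real k *\<^sub>R (g - id_blinfun))"
    by (rule blinfun_eqI) (simp add: blinfun.bilinear_simps algebra_simps)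
  also have "norm \<dots> \<le> ?n * (real k * ?n) + (real k * ?n)\<^sup>2"
  proof (intro norm_triangle_mono Suc)
    show "norm ((g - id_blinfun) o\<^sub>L (gpow g k - id_blinfun)) \<le> ?n * (real k * ?n)"
      by (rule order_trans[OF norm_blinfun_compose])
         (intro mult_left_mono norm_gpow_diff assms norm_ge_zero)
  qed
  also have "\<dots> = (real k + (real k)\<^sup>2) * ?n\<^sup>2" by (simp add: power2_eq_square algebra_simps)
  also have "\<dots> \<le> (real (Suc k))\<^sup>2 * ?n\<^sup>2"
    by (intro mult_right_mono) (simp_all add: power2_eq_square algebra_simps)
  finally show ?case by (simp add: power_mult_distrib)
qed simp

lemma norm_gpow_displacement:
  assumes "g \<in> K"
  shows "norm (gpow g k p - p) \<le> real k * norm (g p - p)"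
proof (induction k)
  case (Suc k)
  have "gpow g (Suc k) p - p = g (gpow g k p - p) + (g p - p)"
    by (simp add: blinfun.bilinear_simps)
  also have "norm \<dots> \<le> norm (gpow g k p - p) + norm (g p - p)"
    by (rule norm_triangle_mono) (simp_all add: norm_K assms)
  finally show ?case using Suc by (simp add: algebra_simps)
qed simp

text \<open>The tangent cone of \<open>K\<close> at the identity, which is the Lie algebra of \<open>K\<close>.\<close>

definition lie :: "('v \<Rightarrow>\<^sub>L 'v) set" where
  "lie = {X. \<exists>g r. (\<forall>n::nat. g n \<in> K \<and> r n > 0) \<and> r \<longlonglongrightarrow> 0 \<and>
     (\<lambda>n. (g n - id_blinfun) /\<^sub>R r n) \<longlonglongrightarrow> X}"

text \<open>A replacement for the one-parameter group \<open>exp (t X)\<close>. If \<open>(g\<^sub>n - 1) / r\<^sub>n\<close> tends to \<open>X\<close>, any limit point of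
the powers of \<open>g\<^sub>n\<close> with exponent \<open>\<lfloor>t / r\<^sub>n\<rfloor>\<close> will do: the \<open>k\<close>-th power of \<open>g\<close> differs from
\<open>1 + k (g - 1)\<close> by at most the square of \<open>k \<parallel>g - 1\<parallel>\<close>. The displacement of \<open>p\<close> under these powers
is at most \<open>\<lfloor>t / r\<^sub>n\<rfloor> \<parallel>g\<^sub>n p - p\<parallel>\<close>, which tends to \<open>t \<parallel>X p\<parallel>\<close>; so if \<open>X\<close> kills \<open>p\<close> then the limit
fixes \<open>p\<close>.\<close>

lemma lie_near_group:
  assumes X: "X \<in> lie" and t: "t > 0"
  shows "\<exists>h\<in>K. norm (h - id_blinfun - t *\<^sub>R X) \<le> (t * norm X)\<^sup>2 \<and> (X p = 0 \<longrightarrow> h p = p)"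
proof -
  obtain g r where g: "\<And>n. g n \<in> K" and r: "\<And>n. r n > 0" "r \<longlonglongrightarrow> 0"
    and lim: "(\<lambda>n. (g n - id_blinfun) /\<^sub>R r n) \<longlonglongrightarrow> X"
    using X unfolding lie_def by blast
  define k where "k n = nat \<lfloor>t / r n\<rfloor>" for n
  have kr: "(\<lambda>n. real (k n) * r n) \<longlonglongrightarrow> t"
  proof (rule tendsto_sandwich[where f="\<lambda>n. t - r n" and h="\<lambda>n. t"])
    have pos: "0 \<le> t / r n" for n using t r(1)[of n] by simp
    have k: "real (k n) = of_int \<lfloor>t / r n\<rfloor>" for n
      using pos[of n] by (simp add: k_def)
    have "t / r n - 1 \<le> real (k n)" "real (k n) \<le> t / r n" for n
      unfolding k by linarith+
    then have "(t / r n - 1) * r n \<le> real (k n) * r n" "real (k n) * r n \<le> t / r n * r n" for n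
      using r(1)[of n] by (intro mult_right_mono; simp add: less_imp_le)+
    moreover have "t / r n * r n = t" for n using r(1)[of n] by simp
    ultimately show "\<forall>\<^sub>F n in sequentially. t - r n \<le> real (k n) * r n"
      "\<forall>\<^sub>F n in sequentially. real (k n) * r n \<le> t"
      by (auto simp: left_diff_distrib)
    show "(\<lambda>n. t - r n) \<longlonglongrightarrow> t" using tendsto_diff[OF tendsto_const r(2)] by simp
  qed simp
  have kg: "(\<lambda>n. real (k n) *\<^sub>R (g n - id_blinfun)) \<longlonglongrightarrow> t *\<^sub>R X"
  proof -
    have "(\<lambda>n. (real (k n) * r n) *\<^sub>R ((g n - id_blinfun) /\<^sub>R r n)) \<longlonglongrightarrow> t *\<^sub>R X"
      by (intro tendsto_intros kr lim)
    moreover have "(real (k n) * r n) *\<^sub>R ((g n - id_blinfun) /\<^sub>R r n) = real (k n) *\<^sub>R (g n - id_blinfun)" for n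
      using r(1)[of n] by simp
    ultimately show ?thesis by (simp only:)
  qed
  obtain h s where h: "h \<in> K" and s: "strict_mono s" and hs: "((\<lambda>n. gpow (g n) (k n)) \<circ> s) \<longlonglongrightarrow> h"
    using compact_K[unfolded compact_def, rule_format, of "\<lambda>n. gpow (g n) (k n)"] gpow_K[OF g] by blast
  have hs: "(\<lambda>n. gpow (g (s n)) (k (s n))) \<longlonglongrightarrow> h" using hs by (simp add: o_def)
  have kgs: "(\<lambda>n. real (k (s n)) *\<^sub>R (g (s n) - id_blinfun)) \<longlonglongrightarrow> t *\<^sub>R X"
    using LIMSEQ_subseq_LIMSEQ[OF kg s] by (simp add: o_def)
  have "norm (h - id_blinfun - t *\<^sub>R X) \<le> (norm (t *\<^sub>R X))\<^sup>2"
  proof (rule LIMSEQ_le)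
    show "(\<lambda>n. norm (gpow (g (s n)) (k (s n)) - id_blinfun - real (k (s n)) *\<^sub>R (g (s n) - id_blinfun)))
      \<longlonglongrightarrow> norm (h - id_blinfun - t *\<^sub>R X)"
      by (intro tendsto_intros hs kgs)
    show "(\<lambda>n. (norm (real (k (s n)) *\<^sub>R (g (s n) - id_blinfun)))\<^sup>2) \<longlonglongrightarrow> (norm (t *\<^sub>R X))\<^sup>2"
      by (intro tendsto_intros kgs)
    show "\<exists>N. \<forall>n\<ge>N. norm (gpow (g (s n)) (k (s n)) - id_blinfun - real (k (s n)) *\<^sub>R (g (s n) - id_blinfun))
      \<le> (norm (real (k (s n)) *\<^sub>R (g (s n) - id_blinfun)))\<^sup>2"
      using norm_gpow_linear_error[OF g] by auto
  qed
  moreover have "h p = p" if "X p = 0"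
  proof -
    have "norm (h p - p) \<le> norm (blinfun_apply (t *\<^sub>R X) p)"
    proof (rule LIMSEQ_le)
      show "(\<lambda>n. norm (gpow (g (s n)) (k (s n)) p - p)) \<longlonglongrightarrow> norm (h p - p)"
        by (intro tendsto_intros hs)
      show "(\<lambda>n. norm (blinfun_apply (real (k (s n)) *\<^sub>R (g (s n) - id_blinfun)) p)) \<longlonglongrightarrow> norm (blinfun_apply (t *\<^sub>R X) p)"
        by (intro tendsto_intros kgs)
      show "\<exists>N. \<forall>n\<ge>N. norm (gpow (g (s n)) (k (s n)) p - p)
        \<le> norm (blinfun_apply (real (k (s n)) *\<^sub>R (g (s n) - id_blinfun)) p)"
        using norm_gpow_displacement[OF g] by (auto simp: blinfun.bilinear_simps)
    qed
    then show ?thesis using that by (simp add: blinfun.bilinear_simps)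
  qed
  ultimately show ?thesis using h t by (auto simp: abs_mult)
qed

lemma uminus_lie:
  assumes "X \<in> lie"
  shows "- X \<in> lie"
proof -
  obtain g r where g: "\<And>n. g n \<in> K" and r: "\<And>n. r n > 0" "r \<longlonglongrightarrow> 0"
    and lim: "(\<lambda>n. (g n - id_blinfun) /\<^sub>R r n) \<longlonglongrightarrow> X"
    using assms unfolding lie_def by blast
  have "\<forall>n. \<exists>h. h \<in> K \<and> h o\<^sub>L g n = id_blinfun"
    using inverse_K[OF g] by blast
  then obtain h where h: "\<And>n. h n \<in> K" "\<And>n. h n o\<^sub>L g n = id_blinfun" by metis
  have d: "(h n - id_blinfun) = - (h n o\<^sub>L (g n - id_blinfun))" for n
  proof (rule blinfun_eqI)
    fix x show "(h n - id_blinfun) x = (- (h n o\<^sub>L (g n - id_blinfun))) x"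
      using arg_cong[OF h(2)[of n], of "\<lambda>f. blinfun_apply f x"] by (simp add: blinfun.bilinear_simps)
  qed
  have g1: "(\<lambda>n. g n - id_blinfun) \<longlonglongrightarrow> 0"
  proof -
    have "(\<lambda>n. r n *\<^sub>R ((g n - id_blinfun) /\<^sub>R r n)) \<longlonglongrightarrow> 0 *\<^sub>R X"
      by (intro tendsto_intros r lim)
    moreover have "r n *\<^sub>R ((g n - id_blinfun) /\<^sub>R r n) = g n - id_blinfun" for n
      using r(1)[of n] by simp
    ultimately show ?thesis by simp
  qed
  have h1: "h \<longlonglongrightarrow> id_blinfun"
  proof -
    have "(\<lambda>n. h n - id_blinfun) \<longlonglongrightarrow> 0"
    proof (rule Lim_null_comparison[OF _ tendsto_norm_zero[OF g1]])
      show "\<forall>\<^sub>F n in sequentially. norm (h n - id_blinfun) \<le> norm (g n - id_blinfun)"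
        unfolding d norm_minus_cancel by (intro always_eventually allI norm_compose_K h)
    qed
    then show ?thesis by (simp add: LIM_zero_iff)
  qed
  have "(\<lambda>n. - (h n o\<^sub>L ((g n - id_blinfun) /\<^sub>R r n))) \<longlonglongrightarrow> - (id_blinfun o\<^sub>L X)"
    by (intro tendsto_minus bounded_bilinear.tendsto[OF bounded_bilinear_blinfun_compose] h1 lim)
  moreover have "- (h n o\<^sub>L ((g n - id_blinfun) /\<^sub>R r n)) = (h n - id_blinfun) /\<^sub>R r n" for n
    unfolding d by (rule blinfun_eqI) (simp add: blinfun.bilinear_simps)
  moreover have "id_blinfun o\<^sub>L X = X" by (rule blinfun_eqI) simp
  ultimately have "(\<lambda>n. (h n - id_blinfun) /\<^sub>R r n) \<longlonglongrightarrow> - X" by simp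
  then show ?thesis using h(1) r unfolding lie_def by blast
qed

lemma nearest_coset_representative:
  assumes "q \<in> orb p"
  obtains g where "g \<in> K" "g p = q"
    "\<And>h. h \<in> K \<Longrightarrow> h p = q \<Longrightarrow> norm (g - id_blinfun) \<le> norm (h - id_blinfun)"
proof -
  have "closed {g. blinfun_apply g p = q}"
    by (intro closed_Collect_eq continuous_intros)
  then have "compact (K \<inter> {g. blinfun_apply g p = q})"
    by (intro compact_Int_closed compact_K)
  moreover have "K \<inter> {g. blinfun_apply g p = q} \<noteq> {}"
    using assms by (auto simp: orb_def)
  moreover have "continuous_on (K \<inter> {g. blinfun_apply g p = q}) (\<lambda>g. norm (g - id_blinfun))"
    by (intro continuous_intros)
  ultimately obtain g where "g \<in> K \<inter> {g. blinfun_apply g p = q}"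
    "\<forall>h\<in>K \<inter> {g. blinfun_apply g p = q}. norm (g - id_blinfun) \<le> norm (h - id_blinfun)"
    using continuous_attains_inf by blast
  then show ?thesis using that by blast
qed

lemma norm_compose_inverse_diff:
  assumes "h \<in> K" "h o\<^sub>L h' = id_blinfun" "h' \<in> K"
  shows "norm ((g o\<^sub>L h') - id_blinfun) \<le> norm (g - h)"
proof -
  have "(g o\<^sub>L h') - id_blinfun = (g - h) o\<^sub>L h'"
  proof (rule blinfun_eqI)
    fix x show "((g o\<^sub>L h') - id_blinfun) x = ((g - h) o\<^sub>L h') x"
      using arg_cong[OF assms(2), of "\<lambda>f. blinfun_apply f x"] by (simp add: blinfun.bilinear_simps)
  qed
  then show ?thesis using norm_compose_right_K[OF assms(3)] by simp
qed

text \<open>Tangent vectors of an orbit come from infinitesimal motions. Write \<open>q\<^sub>n = g\<^sub>n p\<close> with \<open>g\<^sub>n\<close> as close to the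
identity as possible, and let \<open>X\<close> be a limit point of \<open>(g\<^sub>n - 1) / \<parallel>g\<^sub>n - 1\<parallel>\<close>. If \<open>X p \<noteq> 0\<close>, the direction of
\<open>q\<^sub>n - p\<close> tends to that of \<open>X p\<close>. If \<open>X p = 0\<close>, there are elements \<open>h\<close> of the isotropy group of \<open>p\<close> with
\<open>h = 1 + \<parallel>g\<^sub>n - 1\<parallel> X\<close> up to second order, and \<open>g\<^sub>n h\<^sup>-\<^sup>1\<close>, which also takes \<open>p\<close> to \<open>q\<^sub>n\<close>, is closer to the
identity than \<open>g\<^sub>n\<close>.\<close>

lemma tangent_orthogonal_of_lie_orthogonal:
  assumes orth: "\<And>X. X \<in> lie \<Longrightarrow> \<xi> \<bullet> X p = 0"
    and q: "\<And>n::nat. q n \<in> orb p" and t: "\<And>n. t n > 0" "t \<longlonglongrightarrow> 0"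
    and v: "(\<lambda>n. (q n - p) /\<^sub>R t n) \<longlonglongrightarrow> v"
  shows "\<xi> \<bullet> v = 0"
proof (rule ccontr)
  assume ne: "\<xi> \<bullet> v \<noteq> 0"
  then have "v \<noteq> 0" by auto
  then have "\<forall>\<^sub>F n in sequentially. (q n - p) /\<^sub>R t n \<noteq> 0"
    using tendsto_imp_eventually_ne[OF v] by blast
  then obtain N where N: "\<And>n. n \<ge> N \<Longrightarrow> q n \<noteq> p"
    by (auto simp: eventually_sequentially)
  have "\<forall>n. \<exists>g :: 'v \<Rightarrow>\<^sub>L 'v. g \<in> K \<and> g p = q n \<and>
    (\<forall>h :: 'v \<Rightarrow>\<^sub>L 'v. h \<in> K \<longrightarrow> h p = q n \<longrightarrow> norm (g - id_blinfun) \<le> norm (h - id_blinfun))"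
    using nearest_coset_representative[OF q] by metis
  then obtain g where g: "\<And>n. g n \<in> K" "\<And>n. g n p = q n"
    and min: "\<And>n (h :: 'v \<Rightarrow>\<^sub>L 'v). h \<in> K \<Longrightarrow> h p = q n \<Longrightarrow> norm (g n - id_blinfun) \<le> norm (h - id_blinfun)"
    by metis
  define r where "r n = norm (g n - id_blinfun)" for n
  have qp: "q \<longlonglongrightarrow> p"
  proof -
    have "(\<lambda>n. p + t n *\<^sub>R ((q n - p) /\<^sub>R t n)) \<longlonglongrightarrow> p + 0 *\<^sub>R v"
      by (intro tendsto_intros t v)
    moreover have "p + t n *\<^sub>R ((q n - p) /\<^sub>R t n) = q n" for n using t(1)[of n] by simp
    ultimately show ?thesis by simp
  qed
  \<comment> \<open>Correcting by the limit \<open>g0\<close>, which fixes \<open>p\<close>, shows that the nearest elements tend to the identity.\<close>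
  obtain g0 s where g0: "g0 \<in> K" and s: "strict_mono s" and gs: "(g \<circ> s) \<longlonglongrightarrow> g0"
    using compact_K[unfolded compact_def, rule_format, of g] g(1) by blast
  have gs: "(\<lambda>n. g (s n)) \<longlonglongrightarrow> g0" using gs by (simp add: o_def)
  have "(\<lambda>n. g (s n) p) \<longlonglongrightarrow> g0 p" by (intro tendsto_intros gs)
  moreover have "(\<lambda>n. g (s n) p) \<longlonglongrightarrow> p" using LIMSEQ_subseq_LIMSEQ[OF qp s] g(2) by (simp add: o_def)
  ultimately have g0p: "g0 p = p" by (rule LIMSEQ_unique)
  obtain g0' where g0': "g0' \<in> K" "g0 o\<^sub>L g0' = id_blinfun" "\<And>x. g0' (g0 x) = x"
    by (rule inverse_K_apply[OF g0]) blast
  have g0'p: "g0' p = p" using g0'(3)[of p] g0p by simp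
  have rs: "(\<lambda>n. r (s n)) \<longlonglongrightarrow> 0"
  proof (rule Lim_null_comparison)
    have "r (s n) \<le> norm (g (s n) - g0)" for n
    proof -
      have "r (s n) \<le> norm ((g (s n) o\<^sub>L g0') - id_blinfun)"
        unfolding r_def by (rule min) (simp_all add: compose_K g g0' g0'p)
      also have "\<dots> \<le> norm (g (s n) - g0)" by (rule norm_compose_inverse_diff[OF g0 g0'(2,1)])
      finally show ?thesis .
    qed
    then show "\<forall>\<^sub>F n in sequentially. norm (r (s n)) \<le> norm (g (s n) - g0)"
      by (simp add: r_def)
    show "(\<lambda>n. norm (g (s n) - g0)) \<longlonglongrightarrow> 0" using gs by (intro tendsto_norm_zero LIM_zero)
  qed
  \<comment> \<open>From index \<open>N\<close> on \<open>q n \<noteq> p\<close>, so that the normalisation makes sense.\<close>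
  define Y where "Y n = (g n - id_blinfun) /\<^sub>R r n" for n
  have rpos: "r n > 0" if "n \<ge> N" for n
    using N[OF that] g(2)[of n] by (auto simp: r_def)
  have sN: "s (n + N) \<ge> N" for n using seq_suble[OF s, of "n + N"] by linarith
  have "Y (s (n + N)) \<in> sphere 0 1" for n
    using rpos[OF sN[of n]] by (simp add: Y_def) (simp add: r_def)
  moreover have "compact (sphere (0 :: 'v \<Rightarrow>\<^sub>L 'v) 1)"
    unfolding compact_eq_bounded_closed
  proof
    show "bounded (sphere (0 :: 'v \<Rightarrow>\<^sub>L 'v) 1)"
      by (rule bounded_subset[OF bounded_cball sphere_cball])
    show "closed (sphere (0 :: 'v \<Rightarrow>\<^sub>L 'v) 1)"
      unfolding cball_diff_eq_sphere[symmetric] by (intro closed_Diff closed_cball open_ball) 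
  qed
  ultimately obtain X s' where X: "X \<in> sphere 0 1" and s': "strict_mono s'"
    and Ys: "((\<lambda>n. Y (s (n + N))) \<circ> s') \<longlonglongrightarrow> X"
    unfolding compact_def by meson
  define m where "m n = s (s' n + N)" for n
  have m: "strict_mono m" using s s' by (auto simp: m_def strict_mono_def)
  have Ym: "(\<lambda>n. Y (m n)) \<longlonglongrightarrow> X" using Ys by (simp add: o_def m_def)
  have rm: "(\<lambda>n. r (m n)) \<longlonglongrightarrow> 0"
    using LIMSEQ_subseq_LIMSEQ[OF LIMSEQ_ignore_initial_segment[OF rs, of N] s'] by (simp add: o_def m_def)
  have rmpos: "r (m n) > 0" for n using rpos[OF sN] by (simp add: m_def)
  have lie: "X \<in> lie"
    unfolding lie_def mem_Collect_eq
    by (rule exI[of _ "\<lambda>n. g (m n)"], rule exI[of _ "\<lambda>n. r (m n)"])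
      (use g(1) rmpos rm Ym in \<open>simp add: Y_def\<close>)
  have Yp: "(q (m n) - p) /\<^sub>R r (m n) = Y (m n) p" for n
    using g(2)[of "m n"] by (simp add: Y_def blinfun.bilinear_simps)
  show False
  proof (cases "X p = 0")
    case True
    have "1 \<le> norm (Y (m n) - X) + r (m n)" for n
    proof -
      let ?r = "r (m n)"
      obtain h where h: "h \<in> K" "norm (h - id_blinfun - ?r *\<^sub>R X) \<le> ?r\<^sup>2" "h p = p"
        using lie_near_group[OF lie rmpos[of n], of p] True X by auto
      obtain h' where h': "h' \<in> K" "h o\<^sub>L h' = id_blinfun" "\<And>x. h' (h x) = x"
        by (rule inverse_K_apply[OF h(1)]) blast
      have h'p: "h' p = p" using h'(3)[of p] h(3) by simp
      have "?r \<le> norm ((g (m n) o\<^sub>L h') - id_blinfun)"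
        unfolding r_def by (rule min) (simp_all add: compose_K g h' h'p)
      also have "\<dots> \<le> norm (g (m n) - h)" by (rule norm_compose_inverse_diff[OF h(1) h'(2,1)])
      also have "g (m n) - h = ?r *\<^sub>R (Y (m n) - X) - (h - id_blinfun - ?r *\<^sub>R X)"
        using rmpos[of n] by (simp add: Y_def algebra_simps)
      also have "norm \<dots> \<le> ?r * norm (Y (m n) - X) + ?r\<^sup>2"
        using norm_triangle_ineq4[of "?r *\<^sub>R (Y (m n) - X)" "h - id_blinfun - ?r *\<^sub>R X"] h(2) rmpos[of n]
        by simp
      finally have "?r * 1 \<le> ?r * (norm (Y (m n) - X) + ?r)"
        by (simp add: power2_eq_square distrib_left)
      then show ?thesis using rmpos[of n] by (simp only: mult_le_cancel_left_pos)
    qed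
    moreover have "(\<lambda>n. norm (Y (m n) - X) + r (m n)) \<longlonglongrightarrow> 0 + 0"
      by (intro tendsto_add rm tendsto_norm_zero LIM_zero Ym)
    ultimately have "1 \<le> (0::real)"
      using LIMSEQ_le_const[of "\<lambda>n. norm (Y (m n) - X) + r (m n)" 0 1] by auto
    then show False by simp
  next
    case False
    have a: "(\<lambda>n. norm ((q (m n) - p) /\<^sub>R t (m n))) \<longlonglongrightarrow> norm v"
      using LIMSEQ_subseq_LIMSEQ[OF tendsto_norm[OF v] m] by (simp add: o_def)
    have Xp: "(\<lambda>n. (q (m n) - p) /\<^sub>R r (m n)) \<longlonglongrightarrow> X p"
      unfolding Yp by (intro tendsto_intros Ym)
    have "(\<lambda>n. (\<xi> \<bullet> ((q (m n) - p) /\<^sub>R r (m n))) *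
        (norm ((q (m n) - p) /\<^sub>R t (m n)) / norm ((q (m n) - p) /\<^sub>R r (m n))))
      \<longlonglongrightarrow> (\<xi> \<bullet> X p) * (norm v / norm (X p))"
      using False by (intro tendsto_intros a Xp) auto
    moreover have "(\<xi> \<bullet> ((q (m n) - p) /\<^sub>R r (m n))) *
        (norm ((q (m n) - p) /\<^sub>R t (m n)) / norm ((q (m n) - p) /\<^sub>R r (m n)))
      = \<xi> \<bullet> ((q (m n) - p) /\<^sub>R t (m n))" for n
    proof -
      have "norm (q (m n) - p) \<noteq> 0" using N[OF sN] by (simp add: m_def)
      then show ?thesis using rmpos[of n] t(1)[of "m n"] by (simp add: divide_simps)
    qed
    ultimately have "(\<lambda>n. \<xi> \<bullet> ((q (m n) - p) /\<^sub>R t (m n))) \<longlonglongrightarrow> (\<xi> \<bullet> X p) * (norm v / norm (X p))"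
      by (simp only:)
    then have "(\<lambda>n. \<xi> \<bullet> ((q (m n) - p) /\<^sub>R t (m n))) \<longlonglongrightarrow> 0"
      unfolding orth[OF lie] by (simp only: mult_zero_left)
    moreover have "(\<lambda>n. \<xi> \<bullet> ((q (m n) - p) /\<^sub>R t (m n))) \<longlonglongrightarrow> \<xi> \<bullet> v"
      using LIMSEQ_subseq_LIMSEQ[OF tendsto_inner[OF tendsto_const v] m] by (simp add: o_def)
    ultimately show False using ne LIMSEQ_unique by blast
  qed
qed

lemma lie_orthogonal_imp_normal:
  assumes "\<And>X. X \<in> lie \<Longrightarrow> \<xi> \<bullet> X p = 0"
  shows "\<xi> \<in> normal_space (orb p) p"
proof -
  have "v \<bullet> \<xi> = 0" if v: "v \<in> tangent_space (orb p) p" for v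
  proof -
    obtain \<gamma> e where e: "e > (0::real)" and \<gamma>: "\<gamma> ` {-e<..<e} \<subseteq> orb p" "\<gamma> 0 = p"
      and d: "(\<gamma> has_vector_derivative v) (at 0)"
      using v unfolding tangent_space_def by blast
    define t where "t n = e / real (n + 2)" for n
    have t: "t n > 0" "t n < e" for n using e by (auto simp: t_def field_simps intro: add_pos_nonneg)
    have t0: "t \<longlonglongrightarrow> 0"
      unfolding t_def using LIMSEQ_ignore_initial_segment[OF lim_const_over_n[of e], of 2] by simp
    have "filterlim t (at 0) sequentially"
      using t0 t(1) by (intro filterlim_atI) (auto intro!: always_eventually simp: less_imp_neq[symmetric])
    moreover have "(\<lambda>h. norm (\<gamma> (0 + h) - \<gamma> 0 - h *\<^sub>R v) / norm h) \<midarrow>0\<rightarrow> 0"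
      using d unfolding has_vector_derivative_def has_derivative_at by blast
    ultimately have "(\<lambda>n. norm (\<gamma> (0 + t n) - \<gamma> 0 - t n *\<^sub>R v) / norm (t n)) \<longlonglongrightarrow> 0"
      by (rule filterlim_compose[rotated])
    moreover have "norm (\<gamma> (0 + t n) - \<gamma> 0 - t n *\<^sub>R v) / norm (t n) = norm ((\<gamma> (t n) - p) /\<^sub>R t n - v)" for n
    proof -
      have "(\<gamma> (t n) - p) /\<^sub>R t n - v = (\<gamma> (0 + t n) - \<gamma> 0 - t n *\<^sub>R v) /\<^sub>R t n"
        using t(1)[of n] by (simp add: \<gamma>(2) scaleR_right_diff_distrib)
      then show ?thesis using t(1)[of n] by (simp only: norm_scaleR) (simp add: divide_simps)
    qed
    ultimately have "(\<lambda>n. norm ((\<gamma> (t n) - p) /\<^sub>R t n - v)) \<longlonglongrightarrow> 0"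
      by (simp only:)
    then have "(\<lambda>n. (\<gamma> (t n) - p) /\<^sub>R t n) \<longlonglongrightarrow> v"
      by (rule LIM_zero_cancel[OF tendsto_norm_zero_cancel])
    moreover have "\<gamma> (t n) \<in> orb p" for n
      using \<gamma>(1) t[of n] by (auto simp: image_subset_iff)
    ultimately have "\<xi> \<bullet> v = 0"
      using tangent_orthogonal_of_lie_orthogonal[OF _ _ t(1) t0, where q="\<lambda>n. \<gamma> (t n)" and p=p and \<xi>=\<xi>] assms
      by metis
    then show ?thesis by (simp add: inner_commute)
  qed
  then show ?thesis by (auto simp: orthogonal_comp_def orthogonal_def)
qed

lemma lie_critical:
  assumes max: "\<And>h. h \<in> K \<Longrightarrow> y \<bullet> h s \<le> y \<bullet> s" and X: "X \<in> lie"
  shows "y \<bullet> X s = 0"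
proof -
  have le: "y \<bullet> X s \<le> 0" if X: "X \<in> lie" for X
  proof -
    obtain g r where g: "\<And>n. g n \<in> K" and r: "\<And>n. r n > 0" "r \<longlonglongrightarrow> 0"
      and lim: "(\<lambda>n. (g n - id_blinfun) /\<^sub>R r n) \<longlonglongrightarrow> X"
      using X unfolding lie_def by blast
    have "(\<lambda>n. y \<bullet> blinfun_apply ((g n - id_blinfun) /\<^sub>R r n) s) \<longlonglongrightarrow> y \<bullet> X s"
      by (intro tendsto_intros lim)
    moreover have "y \<bullet> blinfun_apply ((g n - id_blinfun) /\<^sub>R r n) s \<le> 0" for n
    proof -
      have "y \<bullet> g n s - y \<bullet> s \<le> 0" using max[OF g[of n]] by simp
      then show ?thesis using r(1)[of n]
        by (simp add: blinfun.bilinear_simps inner_diff_right mult_nonneg_nonpos)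
    qed
    ultimately show ?thesis by (intro LIMSEQ_le_const2) auto
  qed
  from le[OF X] le[OF uminus_lie[OF X]] show ?thesis
    by (simp add: blinfun.bilinear_simps)
qed

section \<open>Transversal points\<close>

text \<open>That is, \<open>S\<close> and the vectors \<open>X s\<close> with \<open>X \<in> lie\<close> together span the whole space.\<close>

definition transversal :: "'v set \<Rightarrow> 'v \<Rightarrow> bool" where
  "transversal S s \<longleftrightarrow> (\<forall>\<xi>\<in>S\<^sup>\<bottom>. (\<forall>X\<in>lie. \<xi> \<bullet> X s = 0) \<longrightarrow> \<xi> = 0)"

text \<open>Otherwise every small \<open>\<tau>\<close> has a vector \<open>\<xi>\<^sub>\<tau> \<noteq> 0\<close> in the orthogonal complement of \<open>S\<close> with
\<open>\<langle>\<xi>\<^sub>\<tau>, X u\<rangle> = - \<tau> \<langle>\<xi>\<^sub>\<tau>, X p\<rangle>\<close> for all \<open>X \<in> lie\<close>, an eigenvector of a pencil with eigenvalue \<open>- \<tau>\<close>.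
More of these than the dimension cannot be independent.\<close>

lemma transversal_perturbation:
  assumes p: "transversal S p" and e: "e > 0"
  shows "\<exists>\<tau>. 0 < \<tau> \<and> \<tau> < e \<and> transversal S (u + \<tau> *\<^sub>R p)"
proof (rule ccontr)
  assume "\<not> ?thesis"
  then have "\<forall>\<tau>\<in>{0<..<e}. \<exists>\<xi>. \<xi> \<in> S\<^sup>\<bottom> \<and> (\<forall>X\<in>lie. \<xi> \<bullet> X (u + \<tau> *\<^sub>R p) = 0) \<and> \<xi> \<noteq> 0"
    unfolding transversal_def by (metis greaterThanLessThan_iff)
  then obtain \<xi> where \<xi>: "\<And>\<tau>. \<tau> \<in> {0<..<e} \<Longrightarrow> \<xi> \<tau> \<in> S\<^sup>\<bottom>"
    "\<And>\<tau> X. \<tau> \<in> {0<..<e} \<Longrightarrow> X \<in> lie \<Longrightarrow> \<xi> \<tau> \<bullet> X (u + \<tau> *\<^sub>R p) = 0"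
    "\<And>\<tau>. \<tau> \<in> {0<..<e} \<Longrightarrow> \<xi> \<tau> \<noteq> 0"
    by metis
  have pencil: "\<xi> \<tau> \<bullet> X u = - \<tau> * (\<xi> \<tau> \<bullet> X p)" if "\<tau> \<in> {0<..<e}" "X \<in> lie" for \<tau> X
    using \<xi>(2)[OF that] by (simp add: blinfun.bilinear_simps inner_add_right)
  have indep: "c \<tau> = 0" if T: "finite T" "T \<subseteq> {0<..<e}" and sum: "(\<Sum>\<tau>\<in>T. c \<tau> *\<^sub>R \<xi> \<tau>) = 0" and \<tau>: "\<tau> \<in> T" for T c \<tau>
  proof -
    have "c \<tau> *\<^sub>R \<xi> \<tau> = 0"
    proof (rule distinct_ratios_imp_independent[where L=lie and f="\<lambda>X \<xi>. \<xi> \<bullet> blinfun_apply X u"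
          and g="\<lambda>X \<xi>. \<xi> \<bullet> blinfun_apply X p" and N="S\<^sup>\<bottom>" and I=T and \<mu>="\<lambda>\<tau>. - \<tau>"
          and w="\<lambda>\<tau>. c \<tau> *\<^sub>R \<xi> \<tau>"])
      show "linear (\<lambda>\<xi>. \<xi> \<bullet> blinfun_apply X u)" "linear (\<lambda>\<xi>. \<xi> \<bullet> blinfun_apply X p)" for X
        by (auto intro!: linearI simp: inner_add_left)
      show "\<xi> = 0" if "\<xi> \<in> S\<^sup>\<bottom>" "\<And>X. X \<in> lie \<Longrightarrow> \<xi> \<bullet> blinfun_apply X p = 0" for \<xi>
        using p that unfolding transversal_def by blast
      show "subspace (S\<^sup>\<bottom>)" by (rule subspace_orthogonal_comp)
      show "c \<tau> *\<^sub>R \<xi> \<tau> \<in> S\<^sup>\<bottom>" if "\<tau> \<in> T" for \<tau>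
        using \<xi>(1) T(2) that by (intro subspace_scale subspace_orthogonal_comp) auto
      show "(c \<tau> *\<^sub>R \<xi> \<tau>) \<bullet> blinfun_apply X u = - \<tau> * ((c \<tau> *\<^sub>R \<xi> \<tau>) \<bullet> blinfun_apply X p)"
        if "\<tau> \<in> T" "X \<in> lie" for \<tau> X
        using pencil[of \<tau> X] T(2) that by auto
    qed (use T sum \<tau> in auto)
    then show ?thesis using \<xi>(3) T(2) \<tau> by auto
  qed
  obtain T where T: "finite T" "card T = Suc DIM('v)" "T \<subseteq> {0<..<e}"
    using infinite_arbitrarily_large[OF infinite_Ioo[OF e]] by blast
  have inj: "inj_on \<xi> T"
  proof (rule inj_onI, rule ccontr)
    fix a b assume ab: "a \<in> T" "b \<in> T" "\<xi> a = \<xi> b" "a \<noteq> b"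
    have "(if a = a then 1 else - 1 :: real) = 0"
      by (rule indep[of "{a, b}" "\<lambda>\<tau>. if \<tau> = a then 1 else - 1"]) (use ab T(3) in auto)
    then show False by simp
  qed
  have "independent (\<xi> ` T)"
  proof (rule ccontr)
    assume "\<not> independent (\<xi> ` T)"
    then obtain c where c: "\<exists>v\<in>\<xi> ` T. c v \<noteq> 0" "(\<Sum>v\<in>\<xi> ` T. c v *\<^sub>R v) = 0"
      using dependent_finite[of "\<xi> ` T"] T(1) by auto
    have "(\<Sum>\<tau>\<in>T. c (\<xi> \<tau>) *\<^sub>R \<xi> \<tau>) = 0"
      using c(2) by (simp add: sum.reindex[OF inj] o_def)
    then show False using indep[OF T(1,3), of "\<lambda>\<tau>. c (\<xi> \<tau>)"] c(1) by auto
  qed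
  then have "card (\<xi> ` T) \<le> DIM('v)" using independent_bound by blast
  then show False using card_image[OF inj] T(2) by simp
qed

text \<open>The points \<open>y\<close> and \<open>s\<close> minimise \<open>\<parallel>y - s\<parallel> + l \<parallel>s - u\<parallel>\<close> over the orbit of \<open>w\<close> and \<open>S\<close>. The penalty keeps \<open>s\<close>
near \<open>u\<close>. It does not depend on the group element, so \<open>y - s\<close> is exactly orthogonal to the
infinitesimal motions of \<open>s\<close>, while it is orthogonal to \<open>S\<close> up to a relative error \<open>2 l\<close>.\<close>

lemma penalised_nearest_point:
  assumes S: "subspace S" "u \<in> S" and l: "l > 0" and w: "norm (w - u) \<le> l\<^sup>2"
  shows "\<exists>y s. y \<in> orb w \<and> s \<in> S \<and> norm (s - u) \<le> l \<and> (\<forall>X\<in>lie. (y - s) \<bullet> X s = 0) \<and>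
    (\<forall>v\<in>S. \<bar>(y - s) \<bullet> v\<bar> \<le> 2 * l * norm (y - s) * norm v)"
proof -
  \<comment> \<open>Large enough for the ball to contain \<open>u\<close> and the projections to \<open>S\<close> of all points of the orbit.\<close>
  define R where "R = norm w + norm u"
  define F where "F = (\<lambda>z. norm (blinfun_apply (fst z) w - snd z) + l * norm (snd z - u))"
  have "compact (K \<times> (cball 0 R \<inter> S))"
    by (intro compact_Times compact_K compact_Int_closed compact_cball closed_subspace S)
  moreover have "u \<in> cball 0 R" by (simp add: R_def)
  then have "K \<times> (cball 0 R \<inter> S) \<noteq> {}" using id_K S(2) by blast
  moreover have "continuous_on (K \<times> (cball 0 R \<inter> S)) F"
    unfolding F_def by (intro continuous_intros)
  ultimately obtain z where z: "z \<in> K \<times> (cball 0 R \<inter> S)"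
    and z': "\<forall>z'\<in>K \<times> (cball 0 R \<inter> S). F z \<le> F z'"
    using continuous_attains_inf by blast
  obtain g s where gs: "z = (g, s)" "g \<in> K" "s \<in> S" "norm s \<le> R" using z by auto
  have min: "norm (g w - s) + l * norm (s - u) \<le> norm (h w - a) + l * norm (a - u)"
    if "h \<in> K" "a \<in> S" "norm a \<le> R" for h a
    using z'[rule_format, of "(h, a)"] that gs(1) by (simp add: F_def)
  define y where "y = g w"
  have y: "y \<in> orb w" using gs(2) by (auto simp: y_def orb_def)
  have ny: "norm y = norm w" using gs(2) by (simp add: y_def norm_K)
  have "l * norm (s - u) \<le> l * l"
  proof -
    have "norm (g w - s) + l * norm (s - u) \<le> norm (w - u)"
      using min[OF id_K S(2)] by (simp add: R_def)
    then show ?thesis using w norm_ge_zero[of "g w - s"] unfolding power2_eq_square by linarith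
  qed
  then have 1: "norm (s - u) \<le> l" using l by simp
  have 2: "(y - s) \<bullet> X s = 0" if X: "X \<in> lie" for X
  proof -
    have "y \<bullet> X s = 0"
    proof (rule lie_critical[OF _ X])
      fix h assume "h \<in> K"
      then obtain h' where h': "h' \<in> K" "\<And>x z. h x \<bullet> z = x \<bullet> h' z"
        by (rule inverse_K_apply) blast
      have "norm (y - s) \<le> norm (h' y - s)"
        using min[OF compose_K[OF h'(1) gs(2)] gs(3,4)] by (simp add: y_def)
      then have "(norm (y - s))\<^sup>2 \<le> (norm (h' y - s))\<^sup>2" by simp
      then have "h' y \<bullet> s \<le> y \<bullet> s"
        by (simp add: power2_norm_eq_inner inner_diff_left inner_diff_right inner_K[OF h'(1)] inner_commute)
      then show "y \<bullet> h s \<le> y \<bullet> s" using h'(2)[of s y] by (simp add: inner_commute)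
    qed
    moreover have "s \<bullet> X s = 0"
    proof (rule lie_critical[OF _ X])
      fix h assume "h \<in> K"
      then show "s \<bullet> h s \<le> s \<bullet> s"
        using norm_cauchy_schwarz[of s "h s"] by (simp add: norm_K dot_square_norm power2_eq_square)
    qed
    ultimately show ?thesis by (simp add: inner_diff_left)
  qed
  have 3: "\<bar>(y - s) \<bullet> v\<bar> \<le> 2 * l * norm (y - s) * norm v" if v: "v \<in> S" for v
  proof -
    obtain a b where ab: "a \<in> span S" "\<And>w. w \<in> span S \<Longrightarrow> orthogonal b w" "y = a + b"
      by (rule orthogonal_subspace_decomp_exists[of S y]) blast
    have a: "a \<in> S" and b: "\<And>w. w \<in> S \<Longrightarrow> b \<bullet> w = 0"
      using ab(1,2) S(1) by (auto simp: span_eq_iff[THEN iffD2] orthogonal_def)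
    have as: "a - s \<in> S" using a gs(3) S(1) by (simp add: subspace_diff)
    have pyth: "(norm (y - s))\<^sup>2 = (norm b)\<^sup>2 + (norm (a - s))\<^sup>2"
      using b[OF as] ab(3) norm_add_Pythagorean[of b "a - s"] by (simp add: orthogonal_def algebra_simps)
    have "(norm y)\<^sup>2 = (norm a)\<^sup>2 + (norm b)\<^sup>2"
      using b[OF a] ab(3) norm_add_Pythagorean[of a b] by (simp add: orthogonal_def inner_commute)
    then have "(norm a)\<^sup>2 \<le> (norm y)\<^sup>2" by simp
    then have "norm a \<le> norm y" by (rule power2_le_imp_le) simp
    then have aR: "norm a \<le> R" using ny by (simp add: R_def add_increasing2)
    \<comment> \<open>Compare with the projection \<open>a\<close> of \<open>y\<close> to \<open>S\<close> as a competitor of \<open>s\<close>.\<close>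
    have "norm (y - s) + l * norm (s - u) \<le> norm b + l * norm (a - u)"
      using min[OF gs(2) a aR] ab(3) unfolding y_def[symmetric] by simp
    moreover have "l * norm (a - u) \<le> l * (norm (a - s) + norm (s - u))"
      using norm_triangle_ineq[of "a - s" "s - u"] l by simp
    ultimately have D: "norm (y - s) - norm b \<le> l * norm (a - s)"
      by (simp add: distrib_left)
    have "(norm b)\<^sup>2 \<le> (norm (y - s))\<^sup>2" using pyth by simp
    then have bD: "norm b \<le> norm (y - s)" by (rule power2_le_imp_le) simp
    have "norm (a - s) * norm (a - s) = (norm (y - s) - norm b) * (norm (y - s) + norm b)"
      using pyth by (simp add: power2_eq_square algebra_simps)
    also have "\<dots> \<le> (l * norm (a - s)) * (2 * norm (y - s))"
      using D bD l by (intro mult_mono) auto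
    finally have "norm (a - s) * norm (a - s) \<le> norm (a - s) * (2 * l * norm (y - s))"
      by (simp add: algebra_simps)
    then have as_le: "norm (a - s) \<le> 2 * l * norm (y - s)"
      using l by (cases "norm (a - s) = 0") (simp_all add: mult_le_cancel_left)
    have "(y - s) \<bullet> v = (a - s) \<bullet> v"
      using b[OF v] ab(3) by (simp add: inner_diff_left inner_add_left)
    then have "\<bar>(y - s) \<bullet> v\<bar> \<le> norm (a - s) * norm v"
      using Cauchy_Schwarz_ineq2[of "a - s" v] by simp
    also have "\<dots> \<le> 2 * l * norm (y - s) * norm v"
      by (intro mult_right_mono as_le) simp
    finally show ?thesis .
  qed
  from y gs(3) 1 2 3 show ?thesis by blast
qed

text \<open>Apply \<open>penalised_nearest_point\<close> to principal points \<open>w\<close> tending to \<open>u\<close>, with weights \<open>l\<close> tending to zero. If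
no minimum were zero, the unit vectors along \<open>y - s\<close> would have a limit orthogonal both to \<open>S\<close> and to the
infinitesimal motions of \<open>u\<close>, against transversality. And if a minimum is zero, then \<open>y = s\<close> is a principal
point of \<open>S\<close> near \<open>u\<close>.\<close>

lemma transversal_limit_of_principal:
  assumes S: "subspace S" "u \<in> S" and u: "transversal S u" and e: "e > 0"
  shows "\<exists>w\<in>S. principal w \<and> dist w u < e"
proof (rule ccontr)
  assume neg: "\<not> ?thesis"
  define l where "l n = e / real (n + 2)" for n
  have l: "l n > 0" "l n < e" for n
    using e by (auto simp: l_def field_simps intro: add_pos_nonneg)
  have l0: "l \<longlonglongrightarrow> 0"
    unfolding l_def using LIMSEQ_ignore_initial_segment[OF lim_const_over_n[of e], of 2] by simp
  have "\<exists>y s. principal y \<and> s \<in> S \<and> norm (s - u) \<le> l n \<and> (\<forall>X\<in>lie. (y - s) \<bullet> X s = 0) \<and>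
    (\<forall>v\<in>S. \<bar>(y - s) \<bullet> v\<bar> \<le> 2 * l n * norm (y - s) * norm v)" for n
  proof -
    obtain w where w: "principal w" "dist w u < (l n)\<^sup>2"
      using principal_dense[of "(l n)\<^sup>2" u] l(1)[of n] by auto
    have "norm (w - u) \<le> (l n)\<^sup>2" using w(2) by (simp add: dist_norm)
    from penalised_nearest_point[OF S l(1) this] obtain y s where ys: "y \<in> orb w" "s \<in> S"
      "norm (s - u) \<le> l n" "\<forall>X\<in>lie. (y - s) \<bullet> X s = 0"
      "\<forall>v\<in>S. \<bar>(y - s) \<bullet> v\<bar> \<le> 2 * l n * norm (y - s) * norm v" by blast
    have "principal y" using ys(1) principal_apply[OF w(1)] by (auto simp: orb_def)
    with ys show ?thesis by blast
  qed
  then obtain y s where y: "\<And>n. principal (y n)" and s: "\<And>n. s n \<in> S" "\<And>n. norm (s n - u) \<le> l n"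
    and tang: "\<And>n X. X \<in> lie \<Longrightarrow> (y n - s n) \<bullet> X (s n) = 0"
    and small: "\<And>n v. v \<in> S \<Longrightarrow> \<bar>(y n - s n) \<bullet> v\<bar> \<le> 2 * l n * norm (y n - s n) * norm v"
    by metis
  have ne: "y n \<noteq> s n" for n
    using neg y[of n] s[of n] l(2)[of n] by (auto simp: dist_norm)
  define E where "E n = (y n - s n) /\<^sub>R norm (y n - s n)" for n
  have "E n \<in> sphere 0 1" for n using ne[of n] by (simp add: E_def)
  then obtain x r where x: "x \<in> sphere 0 1" and r: "strict_mono r" and Er: "(E \<circ> r) \<longlonglongrightarrow> x"
    using compact_sphere[of "0 :: 'v" 1] unfolding compact_def by meson
  have su: "s \<longlonglongrightarrow> u"
    by (rule LIM_zero_cancel, rule Lim_null_comparison[OF _ l0]) (simp add: s)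
  have x_normal: "x \<bullet> v = 0" if v: "v \<in> S" for v
  proof -
    have "\<bar>E n \<bullet> v\<bar> \<le> 2 * l n * norm v" for n
    proof -
      have "\<bar>E n \<bullet> v\<bar> = \<bar>(y n - s n) \<bullet> v\<bar> / norm (y n - s n)"
        by (simp add: E_def abs_mult divide_inverse)
      also have "\<dots> \<le> 2 * l n * norm v"
        using small[OF v, of n] ne[of n] by (simp add: divide_le_eq mult_ac)
      finally show ?thesis .
    qed
    then have bound: "\<forall>\<^sub>F n in sequentially. norm (E n \<bullet> v) \<le> 2 * l n * norm v" by simp
    have "(\<lambda>n. 2 * l n * norm v) \<longlonglongrightarrow> 2 * 0 * norm v"
      by (intro tendsto_mult tendsto_const l0)
    then have "(\<lambda>n. E n \<bullet> v) \<longlonglongrightarrow> 0"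
      using Lim_null_comparison[OF bound] by simp
    from LIMSEQ_subseq_LIMSEQ[OF this r] have "(\<lambda>n. E (r n) \<bullet> v) \<longlonglongrightarrow> 0" by (simp add: o_def)
    moreover have "(\<lambda>n. E (r n) \<bullet> v) \<longlonglongrightarrow> x \<bullet> v"
      using tendsto_inner[OF Er tendsto_const[of v]] by (simp add: o_def)
    ultimately show ?thesis using LIMSEQ_unique by blast
  qed
  then have "x \<in> S\<^sup>\<bottom>" by (auto simp: orthogonal_comp_def orthogonal_def inner_commute)
  moreover have "x \<bullet> X u = 0" if X: "X \<in> lie" for X
  proof -
    have "E (r n) \<bullet> X (s (r n)) = 0" for n using tang[OF X] by (simp add: E_def)
    moreover have "(\<lambda>n. E (r n) \<bullet> X (s (r n))) \<longlonglongrightarrow> x \<bullet> X u"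
      using Er LIMSEQ_subseq_LIMSEQ[OF su r] by (intro tendsto_intros) (simp_all add: o_def)
    ultimately show ?thesis by (simp add: LIMSEQ_const_iff)
  qed
  ultimately have "x = 0" using u unfolding transversal_def by blast
  then show False using x by simp
qed

section \<open>Maximisers, invariant convex sets and fixed points\<close>

lemma maximizer_normal:
  assumes max: "\<And>h. h \<in> K \<Longrightarrow> h y \<bullet> u \<le> y \<bullet> u"
  shows "y \<in> normal_space (orb u) u"
proof -
  have "v \<bullet> y = 0" if v: "v \<in> tangent_space (orb u) u" for v
  proof -
    obtain \<gamma> e where e: "e > (0::real)" and \<gamma>: "\<gamma> ` {-e<..<e} \<subseteq> orb u" "\<gamma> 0 = u"
      and d: "(\<gamma> has_vector_derivative v) (at 0)"
      using v unfolding tangent_space_def by blast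
    have der: "((\<lambda>t. y \<bullet> \<gamma> t) has_real_derivative y \<bullet> v) (at 0)"
      unfolding has_real_derivative_iff_has_vector_derivative
      by (rule bounded_linear.has_vector_derivative[OF bounded_linear_inner_right d])
    have "y \<bullet> \<gamma> t \<le> y \<bullet> \<gamma> 0" if "\<bar>0 - t\<bar> < e" for t
    proof -
      have "t \<in> {-e<..<e}" using that by auto
      then obtain h where h: "h \<in> K" "\<gamma> t = h u" using \<gamma>(1) unfolding orb_def by blast
      obtain h' where h': "h' \<in> K" "\<And>x z. h x \<bullet> z = x \<bullet> h' z"
        by (rule inverse_K_apply[OF h(1)]) blast
      show ?thesis using max[OF h'(1)] h(2) h'(2)[of u y] \<gamma>(2) by (simp add: inner_commute)
    qed
    then have "y \<bullet> v = 0" using DERIV_local_max[OF der e] by blast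
    then show ?thesis by (simp add: inner_commute)
  qed
  then show ?thesis by (auto simp: orthogonal_comp_def orthogonal_def)
qed

definition invariant :: "'v set \<Rightarrow> bool" where
  "invariant C \<longleftrightarrow> (\<forall>g\<in>K. g ` C \<subseteq> C)"

lemma invariantD: "invariant C \<Longrightarrow> g \<in> K \<Longrightarrow> x \<in> C \<Longrightarrow> g x \<in> C"
  by (auto simp: invariant_def)

text \<open>For \<open>x \<in> C\<close>, the point \<open>c\<close> of smallest norm in the convex hull of the orbit of \<open>x\<close> is fixed by \<open>K\<close>,
hence in \<open>F\<close>. Write it as a convex combination of orbit points with \<open>g x\<close> having a positive coefficient.
Applying the inverse of \<open>g\<close> leaves \<open>c\<close> alone and turns \<open>g x\<close> into \<open>x\<close>, so \<open>x \<in> F\<close> because \<open>F\<close> is a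
face.\<close>

lemma face_containing_fixed_points:
  assumes C: "convex C" "invariant C" and F: "F face_of C"
    and fixed: "\<And>c. c \<in> C \<Longrightarrow> (\<And>g. g \<in> K \<Longrightarrow> g c = c) \<Longrightarrow> c \<in> F"
  shows "C \<subseteq> F"
proof
  fix x assume x: "x \<in> C"
  define D where "D = convex hull orb x"
  have x_orb: "x \<in> orb x" using id_K by (force simp: orb_def)
  have "orb x \<subseteq> C" using invariantD[OF C(2) _ x] by (auto simp: orb_def)
  then have DC: "D \<subseteq> C" unfolding D_def using C(1) by (rule hull_minimal)
  have D: "convex D" "closed D" "D \<noteq> {}"
    using compact_imp_closed[OF compact_convex_hull[OF compact_orb[of x]]] x_orb by (auto simp: D_def)
  have D_inv: "g d \<in> D" if g: "g \<in> K" and d: "d \<in> D" for g d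
  proof -
    have lin: "linear g" by (rule bounded_linear.linear[OF blinfun.bounded_linear_right])
    have "g ` D = convex hull (g ` orb x)"
      unfolding D_def by (rule convex_hull_linear_image[OF lin])
    also have "\<dots> \<subseteq> D"
      unfolding D_def
    proof (rule hull_mono)
      have "g (h x) \<in> orb x" if "h \<in> K" for h
        using compose_K[OF g that] by (force simp: orb_def)
      then show "g ` orb x \<subseteq> orb x" by (auto simp: orb_def[of x])
    qed
    finally show ?thesis using d by blast
  qed
  define c where "c = closest_point D 0"
  have cD: "c \<in> D" using closest_point_in_set[OF D(2,3)] by (simp add: c_def)
  have c_fixed: "g c = c" if g: "g \<in> K" for g
    unfolding c_def
  proof (rule closest_point_unique[OF D(1,2)])
    show "g (closest_point D 0) \<in> D" using D_inv[OF g cD] by (simp add: c_def)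
    show "\<forall>z\<in>D. dist 0 (g (closest_point D 0)) \<le> dist 0 z"
      using closest_point_le[OF D(2), of _ 0] norm_K[OF g] by simp
  qed
  have cF: "c \<in> F" using fixed[of c] cD DC c_fixed by blast
  obtain T a where T: "finite T" "T \<subseteq> orb x" "\<forall>v\<in>T. 0 \<le> a v" "sum a T = 1" "(\<Sum>v\<in>T. a v *\<^sub>R v) = c"
    using cD unfolding D_def convex_hull_explicit by blast
  obtain v where v: "v \<in> T" "a v > 0"
  proof -
    have "\<exists>v\<in>T. a v \<noteq> 0"
    proof (rule ccontr)
      assume "\<not> (\<exists>v\<in>T. a v \<noteq> 0)"
      then have "sum a T = 0" by (intro sum.neutral) blast
      with T(4) show False by simp
    qed
    then show ?thesis using T(3) that by force
  qed
  obtain g where g: "g \<in> K" "v = g x" using v(1) T(2) by (auto simp: orb_def)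
  obtain h where h: "h \<in> K" "\<And>z. h (g z) = z" by (rule inverse_K_apply[OF g(1)]) blast
  have "h v \<in> F"
  proof (rule face_of_contains_summand[OF F C(1) T(1) _ T(4) _ _ v])
    show "h w \<in> C" if "w \<in> T" for w
      using that T(2) \<open>orb x \<subseteq> C\<close> invariantD[OF C(2) h(1)] by blast
    have "(\<Sum>w\<in>T. a w *\<^sub>R h w) = h c"
      unfolding T(5)[symmetric] by (simp add: blinfun.sum_right blinfun.scaleR_right)
    then show "(\<Sum>w\<in>T. a w *\<^sub>R h w) \<in> F" using c_fixed[OF h(1)] cF by simp
  qed (use T(3) in auto)
  then show "x \<in> F" using g(2) h(2) by simp
qed

lemma compact_orthogonal_group_isotropy: "compact_orthogonal_group (isotropy u)"
proof
  have "closed {g. blinfun_apply g u = u}"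
    by (intro closed_Collect_eq continuous_intros)
  then have "compact (K \<inter> {g. blinfun_apply g u = u})"
    by (intro compact_Int_closed compact_K)
  moreover have "isotropy u = K \<inter> {g. blinfun_apply g u = u}" by (auto simp: isotropy_def)
  ultimately show "compact (isotropy u)" by simp
  show "\<exists>h\<in>isotropy u. h o\<^sub>L g = id_blinfun \<and> g o\<^sub>L h = id_blinfun" if "g \<in> isotropy u" for g
  proof -
    have g: "g \<in> K" "g u = u" using that by (auto simp: isotropy_def)
    obtain h where h: "h \<in> K" "\<And>x. h (g x) = x" "h o\<^sub>L g = id_blinfun" "g o\<^sub>L h = id_blinfun"
      by (rule inverse_K_apply[OF g(1)]) blast
    have "h u = u" using h(2)[of u] g(2) by simp
    with h show ?thesis by (auto simp: isotropy_def)
  qed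
qed (auto simp: isotropy_def orthogonal_K id_K compose_K)

end

section \<open>Sections containing the normal spaces of principal orbits\<close>

text \<open>A fat section has these properties because principal points are regular.\<close>

locale normal_section = compact_orthogonal_group +
  fixes S :: "'a set"
  assumes subspace_S: "subspace S"
    and meets_orbits: "\<exists>g\<in>K. g x \<in> S"
    and normal_in_S: "p \<in> S \<Longrightarrow> principal p \<Longrightarrow> normal_space (orb p) p \<subseteq> S"
begin

lemma principal_transversal:
  assumes "p \<in> S" "principal p"
  shows "transversal S p"
  unfolding transversal_def
proof (intro ballI impI)
  fix \<xi> assume \<xi>: "\<xi> \<in> S\<^sup>\<bottom>" "\<forall>X\<in>lie. \<xi> \<bullet> X p = 0"
  then have "\<xi> \<in> S" using lie_orthogonal_imp_normal normal_in_S[OF assms] by blast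
  with \<xi>(1) show "\<xi> = 0" by (auto simp: orthogonal_comp_def orthogonal_def)
qed

lemma principal_dense_in_section:
  assumes u: "u \<in> S" and e: "e > 0"
  shows "\<exists>w\<in>S. principal w \<and> dist w u < e"
proof -
  obtain p0 where "principal p0" using principal_exists by blast
  moreover obtain g where "g \<in> K" "g p0 \<in> S" using meets_orbits by blast
  ultimately obtain p where p: "p \<in> S" "principal p" using principal_apply by blast
  have n0: "norm p + 1 > 0" by (smt (verit) norm_ge_zero)
  then have "e / 2 / (norm p + 1) > 0" using e by simp
  from transversal_perturbation[OF principal_transversal[OF p] this, of u]
  obtain \<tau> where \<tau>: "0 < \<tau>" "\<tau> < e / 2 / (norm p + 1)" "transversal S (u + \<tau> *\<^sub>R p)" by blast
  have "\<tau> * norm p \<le> \<tau> * (norm p + 1)" using \<tau>(1) by simp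
  also have "\<dots> < e / 2" using \<tau>(2) n0 unfolding pos_less_divide_eq[OF n0] by blast
  finally have near: "dist (u + \<tau> *\<^sub>R p) u < e / 2" using \<tau>(1) by (simp add: dist_norm)
  have "u + \<tau> *\<^sub>R p \<in> S" using u p(1) subspace_S by (simp add: subspace_add subspace_scale)
  from transversal_limit_of_principal[OF subspace_S this \<tau>(3), of "e / 2"] e
  obtain w where "w \<in> S" "principal w" "dist w (u + \<tau> *\<^sub>R p) < e / 2" by auto
  moreover from this(3) near have "dist w u < e"
    using dist_triangle[of w u "u + \<tau> *\<^sub>R p"] by linarith
  ultimately show ?thesis by blast
qed

text \<open>Take principal points \<open>w\<^sub>n\<close> of \<open>S\<close> tending to \<open>u\<close> and \<open>g\<^sub>n\<close> maximising \<open>\<langle>g y, w\<^sub>n\<rangle>\<close>, where \<open>y = x + u\<close>. Then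
\<open>g\<^sub>n y\<close> is normal to the orbit of \<open>w\<^sub>n\<close> and so lies in \<open>S\<close>. A limit \<open>k\<close> of the \<open>g\<^sub>n\<close> has \<open>k y \<in> S\<close> and
maximises \<open>\<langle>g y, u\<rangle>\<close>; by the tilt it fixes \<open>u\<close>, whence \<open>k x = k y - u \<in> S\<close>. Without the tilt \<open>k\<close>
need not fix \<open>u\<close>.\<close>

lemma maximizer_isotropy_orbit_meets:
  assumes u: "u \<in> S" and max: "\<And>h. h \<in> K \<Longrightarrow> h x \<bullet> u \<le> x \<bullet> u"
  shows "\<exists>g\<in>isotropy u. g x \<in> S"
proof -
  define y where "y = x + 1 *\<^sub>R u"
  have "\<exists>w. w \<in> S \<and> principal w \<and> dist w u < 1 / real (Suc n)" for n
    using principal_dense_in_section[OF u, of "1 / real (Suc n)"] by auto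
  then obtain w where w: "\<And>n. w n \<in> S" "\<And>n. principal (w n)" "\<And>n. dist (w n) u < 1 / real (Suc n)"
    by metis
  have wu: "w \<longlonglongrightarrow> u"
    by (rule LIM_zero_cancel, rule Lim_null_comparison[OF _ LIMSEQ_Suc[OF lim_1_over_n]])
      (use w(3) in \<open>auto simp: dist_norm less_imp_le\<close>)
  have "\<exists>g. g \<in> K \<and> (\<forall>h\<in>K. h y \<bullet> w n \<le> g y \<bullet> w n)" for n
    using maximum_on_orbit[of y "w n"] by blast
  then obtain g where g: "\<And>n. g n \<in> K" "\<And>n h. h \<in> K \<Longrightarrow> h y \<bullet> w n \<le> g n y \<bullet> w n"
    by metis
  have gS: "g n y \<in> S" for n
  proof -
    have "h (g n y) \<bullet> w n \<le> g n y \<bullet> w n" if "h \<in> K" for h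
      using g(2)[OF compose_K[OF that g(1)], of n n] by simp
    then show ?thesis using maximizer_normal normal_in_S[OF w(1,2)] by blast
  qed
  obtain k r where k: "k \<in> K" and r: "strict_mono r" and gr: "(g \<circ> r) \<longlonglongrightarrow> k"
    using compact_K[unfolded compact_def, rule_format, of g] g(1) by blast
  have gr: "(\<lambda>n. g (r n) y) \<longlonglongrightarrow> k y"
    using gr by (intro tendsto_intros) (simp add: o_def)
  have wr: "(\<lambda>n. w (r n)) \<longlonglongrightarrow> u" using LIMSEQ_subseq_LIMSEQ[OF wu r] by (simp add: o_def)
  have kS: "k y \<in> S"
    using closed_sequentially[OF closed_subspace[OF subspace_S] _ gr] gS by blast
  have "y \<bullet> u \<le> k y \<bullet> u"
  proof (rule LIMSEQ_le)
    show "(\<lambda>n. y \<bullet> w (r n)) \<longlonglongrightarrow> y \<bullet> u" "(\<lambda>n. g (r n) y \<bullet> w (r n)) \<longlonglongrightarrow> k y \<bullet> u"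
      by (intro tendsto_inner tendsto_const wr gr)+
    show "\<exists>N. \<forall>n\<ge>N. y \<bullet> w (r n) \<le> g (r n) y \<bullet> w (r n)"
      using g(2)[OF id_K] by simp
  qed
  then have ku: "k u = u"
    using tilted_maximum_fixes[OF k max[OF k], of 1] by (simp add: y_def)
  have "k x = k y - u" by (simp add: y_def blinfun.bilinear_simps ku)
  then have "k x \<in> S" using subspace_diff[OF subspace_S kS u] by simp
  then show ?thesis using k ku by (auto simp: isotropy_def)
qed

section \<open>Exposed faces of an invariant convex set and of its section\<close>

context
  fixes \<sigma> :: "'a \<Rightarrow> 'a" and E :: "'a set"
  assumes \<sigma>: "orthogonal_projection S \<sigma>"
    and E: "compact E" "convex E" "invariant E"
begin

lemma projection_in_S: "\<sigma> x \<in> S"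
  using \<sigma> by (simp add: orthogonal_projection_def)

lemma inner_projection_left: "u \<in> S \<Longrightarrow> \<sigma> x \<bullet> u = x \<bullet> u"
proof -
  assume "u \<in> S"
  then have "u \<bullet> (x - \<sigma> x) = 0"
    using \<sigma> by (auto simp: orthogonal_projection_def orthogonal_comp_def orthogonal_def)
  then show ?thesis by (simp add: inner_diff_right inner_commute)
qed

lemma inner_projection_right: "u \<in> S \<Longrightarrow> u \<bullet> \<sigma> x = u \<bullet> x"
  using inner_projection_left[of u x] by (simp add: inner_commute)

lemma projection_id: "x \<in> S \<Longrightarrow> \<sigma> x = x"
proof -
  assume "x \<in> S"
  then have "x - \<sigma> x \<in> S" using projection_in_S subspace_diff[OF subspace_S] by blast
  moreover have "x - \<sigma> x \<in> S\<^sup>\<bottom>" using \<sigma> by (simp add: orthogonal_projection_def)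
  ultimately show ?thesis by (auto simp: orthogonal_comp_def orthogonal_def)
qed

text \<open>If \<open>\<sigma>(x) \<notin> E\<close>, separate it from \<open>E\<close>. The maximum over \<open>E\<close> of the functional given by the projection \<open>u\<close>
of the separating direction is attained at a point of \<open>E \<inter> S\<close>, by \<open>maximizer_isotropy_orbit_meets\<close>; on \<open>S\<close> the
two functionals agree.\<close>

lemma projection_eq_section: "\<sigma> ` E = E \<inter> S"
proof
  show "E \<inter> S \<subseteq> \<sigma> ` E" using projection_id by force
  have "\<sigma> x \<in> E" if x: "x \<in> E" for x
  proof (rule ccontr)
    assume "\<sigma> x \<notin> E"
    then obtain a b where ab: "a \<bullet> \<sigma> x < b" "\<And>y. y \<in> E \<Longrightarrow> b < a \<bullet> y"
      using separating_hyperplane_closed_point[OF E(2) compact_imp_closed[OF E(1)]] by blast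
    define u where "u = - \<sigma> a"
    have u: "u \<in> S" using projection_in_S subspace_neg[OF subspace_S] by (simp add: u_def)
    have inner_u: "y \<bullet> u = - (a \<bullet> y)" if "y \<in> S" for y
      using inner_projection_right[OF that, of a] by (simp add: u_def inner_commute)
    have "continuous_on E (\<lambda>y. y \<bullet> u)" by (intro continuous_intros)
    then obtain z where z: "z \<in> E" "\<And>y. y \<in> E \<Longrightarrow> y \<bullet> u \<le> z \<bullet> u"
      using continuous_attains_sup[OF E(1), of "\<lambda>y. y \<bullet> u"] x by blast
    have "h z \<bullet> u \<le> z \<bullet> u" if "h \<in> K" for h
      using z(2)[OF invariantD[OF E(3) that z(1)]] .
    then obtain g where g: "g \<in> isotropy u" "g z \<in> S"
      using maximizer_isotropy_orbit_meets[OF u] by blast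
    have gK: "g \<in> K" "g u = u" using g(1) by (auto simp: isotropy_def)
    have "- (a \<bullet> \<sigma> x) = \<sigma> x \<bullet> u" using inner_u[OF projection_in_S] by simp
    also have "\<dots> = x \<bullet> u" by (rule inner_projection_left[OF u])
    also have "\<dots> \<le> z \<bullet> u" by (rule z(2)[OF x])
    also have "\<dots> = g z \<bullet> u" using inner_K[OF gK(1), of z u] gK(2) by simp
    also have "\<dots> = - (a \<bullet> g z)" by (rule inner_u[OF g(2)])
    finally have "a \<bullet> g z \<le> a \<bullet> \<sigma> x" by simp
    with ab(1) ab(2)[OF invariantD[OF E(3) gK(1) z(1)]] show False by simp
  qed
  then show "\<sigma> ` E \<subseteq> E \<inter> S" using projection_in_S by blast
qed

lemma faces_exposed_imp_section:
  assumes exposed: "faces_exposed UNIV E"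
  shows "faces_exposed S (E \<inter> S)"
  unfolding faces_exposed_def
proof (intro allI impI, elim conjE)
  fix F' assume F': "F' face_of E \<inter> S" "F' \<noteq> {}" "F' \<noteq> E \<inter> S"
  have F'sub: "F' \<subseteq> E \<inter> S" by (rule face_of_imp_subset[OF F'(1)])
  obtain z where z: "z \<in> rel_interior F'"
    using rel_interior_eq_empty[OF face_of_imp_convex[OF F'(1)]] F'(2) by blast
  have zF': "z \<in> F'" using z rel_interior_subset by blast
  then have zE: "z \<in> E" "z \<in> S" using F'sub by auto
  obtain F where F: "F face_of E" "z \<in> rel_interior F"
    by (rule face_with_point_in_rel_interior[OF E(2) zE(1)])
  have zF: "z \<in> F" using F(2) rel_interior_subset by blast
  have eq: "F' = F \<inter> S"
  proof
    have "(F \<inter> S) face_of (E \<inter> S)"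
      by (rule face_of_slice[OF F(1) subspace_imp_convex[OF subspace_S]])
    then show "F' \<subseteq> F \<inter> S"
      by (rule subset_of_face_of[OF _ F'sub]) (use z zF zE in blast)
    show "F \<inter> S \<subseteq> F'"
    proof
      fix y assume y: "y \<in> F \<inter> S"
      show "y \<in> F'"
      proof (cases "y = z")
        case False
        \<comment> \<open>Prolong the segment from \<open>y\<close> through \<open>z\<close> beyond \<open>z\<close> within \<open>F\<close>, to a point \<open>w\<close>.\<close>
        obtain m where m: "m > 1" "(1 - m) *\<^sub>R y + m *\<^sub>R z \<in> F"
          using convex_rel_interior_if[OF face_of_imp_convex[OF F(1)] F(2)] y hull_inc[of y F]
          by fastforce
        define w where "w = (1 - m) *\<^sub>R y + m *\<^sub>R z"
        have w: "w \<in> E \<inter> S"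
          using m(2) y zE(2) face_of_imp_subset[OF F(1)] subspace_S
          by (auto simp: w_def subspace_add subspace_scale)
        have y': "y \<in> E \<inter> S" using y face_of_imp_subset[OF F(1)] by auto
        have z_eq: "z = (1 - 1 / m) *\<^sub>R y + (1 / m) *\<^sub>R w"
        proof -
          have "m *\<^sub>R z = (m - 1) *\<^sub>R y + w" by (simp add: w_def algebra_simps)
          then have "(1 / m) *\<^sub>R (m *\<^sub>R z) = (1 / m) *\<^sub>R ((m - 1) *\<^sub>R y + w)" by simp
          then show ?thesis using m(1) by (simp add: scaleR_right_distrib diff_divide_distrib)
        qed
        have "y \<noteq> w"
        proof
          assume "y = w"
          then have "z = y" using z_eq by (simp flip: scaleR_left_distrib)
          with False show False by simp
        qed
        then have "z \<in> open_segment y w"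
          unfolding in_segment using z_eq m(1) by (intro conjI exI[of _ "1 / m"]) auto
        then show ?thesis using face_ofD[OF F'(1) _ y' w zF'] by blast
      qed (simp add: zF')
    qed
  qed
  have "F \<noteq> E" using eq F'(3) by blast
  then obtain u where u: "F = exposed_face E u"
    using exposed F(1) zF unfolding faces_exposed_def by blast
  have F'eq: "F' = exposed_face (E \<inter> S) (\<sigma> u)"
  proof -
    have "y \<bullet> \<sigma> u = y \<bullet> u" if "y \<in> S" for y by (rule inner_projection_right[OF that])
    moreover have "exposed_face E u \<inter> S = {x \<in> E \<inter> S. \<forall>y\<in>E \<inter> S. y \<bullet> u \<le> x \<bullet> u}"
    proof -
      have "x \<in> exposed_face E u" if "x \<in> E \<inter> S" "\<forall>y\<in>E \<inter> S. y \<bullet> u \<le> x \<bullet> u" for x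
      proof -
        have "z \<bullet> u \<le> x \<bullet> u" using that(2) zE by blast
        moreover have "\<forall>y\<in>E. y \<bullet> u \<le> z \<bullet> u" using zF u by (simp add: exposed_face_def)
        ultimately show ?thesis using that(1) by (force simp: exposed_face_def)
      qed
      then show ?thesis by (auto simp: exposed_face_def)
    qed
    ultimately show ?thesis unfolding eq u by (auto simp: exposed_face_def)
  qed
  moreover have "\<sigma> u \<noteq> 0"
  proof
    assume "\<sigma> u = 0"
    then have "F' = E \<inter> S" using F'eq by (auto simp: exposed_face_def)
    with F'(3) show False by simp
  qed
  ultimately show "\<exists>u\<in>S. u \<noteq> 0 \<and> F' = exposed_face (E \<inter> S) u"
    using projection_in_S by blast
qed

lemma fixed_point_in_section: "(\<And>g. g \<in> K \<Longrightarrow> g c = c) \<Longrightarrow> c \<in> S"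
  using meets_orbits[of c] by force

text \<open>Both steps are instances of \<open>face_containing_fixed_points\<close>. With \<open>K\<close> acting on \<open>E\<close>, it shows that \<open>F \<inter> S\<close> is a
proper face of \<open>E \<inter> S\<close>, so it is exposed by some \<open>u \<in> S\<close>. With the isotropy group of \<open>u\<close>
acting on the face of \<open>E\<close> exposed by \<open>u\<close>, it shows that this face is \<open>F\<close>.\<close>

lemma face_meeting_section_exposed:
  assumes exposed: "faces_exposed S (E \<inter> S)"
    and F: "F face_of E" "F \<noteq> E" and z: "z \<in> rel_interior F" "z \<in> S"
  shows "\<exists>u. u \<noteq> 0 \<and> F = exposed_face E u"
proof -
  have zF: "z \<in> F" using z(1) rel_interior_subset by blast
  have FE: "F \<subseteq> E" by (rule face_of_imp_subset[OF F(1)])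
  have "F \<inter> S \<noteq> E \<inter> S"
  proof
    assume eq: "F \<inter> S = E \<inter> S"
    have "E \<subseteq> F"
    proof (rule face_containing_fixed_points[OF E(2,3) F(1)])
      fix c assume "c \<in> E" "\<And>g. g \<in> K \<Longrightarrow> g c = c"
      then show "c \<in> F" using fixed_point_in_section eq by blast
    qed
    then show False using FE F(2) by blast
  qed
  moreover have "(F \<inter> S) face_of (E \<inter> S)"
    by (rule face_of_slice[OF F(1) subspace_imp_convex[OF subspace_S]])
  moreover have "F \<inter> S \<noteq> {}" using zF z(2) by blast
  ultimately obtain u where u: "u \<in> S" "u \<noteq> 0" "F \<inter> S = exposed_face (E \<inter> S) u"
    using exposed unfolding faces_exposed_def by blast
  have max: "y \<bullet> u \<le> z \<bullet> u" if "y \<in> E" for y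
  proof -
    have "\<sigma> y \<in> E \<inter> S" using projection_eq_section that by blast
    moreover have "z \<in> exposed_face (E \<inter> S) u" using u(3) zF z(2) by blast
    ultimately have "\<sigma> y \<bullet> u \<le> z \<bullet> u" by (simp add: exposed_face_def)
    then show ?thesis by (simp add: inner_projection_left[OF u(1)])
  qed
  have z_exp: "z \<in> exposed_face E u" using max zF FE by (auto simp: exposed_face_def)
  have face: "exposed_face E u face_of E" by (rule exposed_face_is_face[OF E(2) z_exp])
  have 1: "F \<subseteq> exposed_face E u"
    by (rule subset_of_face_of[OF face FE]) (use z_exp z(1) in blast)
  interpret iso: compact_orthogonal_group "isotropy u"
    by (rule compact_orthogonal_group_isotropy)
  have iso_inv: "iso.invariant (exposed_face E u)"
    unfolding iso.invariant_def
  proof clarify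
    fix g x assume g: "g \<in> isotropy u" and x: "x \<in> exposed_face E u"
    have "g \<in> K" "g u = u" using g by (auto simp: isotropy_def)
    then have "g x \<bullet> u = x \<bullet> u" by (metis inner_K)
    then show "g x \<in> exposed_face E u"
      using x invariantD[OF E(3) \<open>g \<in> K\<close>] by (auto simp: exposed_face_def)
  qed
  have F_face: "F face_of exposed_face E u"
    using F(1) 1 face_of_imp_subset[OF face] by (rule face_of_subset)
  have 2: "exposed_face E u \<subseteq> F"
  proof (rule iso.face_containing_fixed_points[OF face_of_imp_convex[OF face] iso_inv F_face])
    fix c assume c: "c \<in> exposed_face E u" "\<And>g. g \<in> isotropy u \<Longrightarrow> g c = c"
    have "h c \<bullet> u \<le> c \<bullet> u" if "h \<in> K" for h
      using c(1) invariantD[OF E(3) that] by (simp add: exposed_face_def)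
    then obtain g where "g \<in> isotropy u" "g c \<in> S"
      using maximizer_isotropy_orbit_meets[OF u(1)] by blast
    then have "c \<in> S" using c(2) by simp
    then have "c \<in> exposed_face (E \<inter> S) u" using c(1) by (auto simp: exposed_face_def)
    then show "c \<in> F" using u(3) by blast
  qed
  from 1 2 u(2) show ?thesis by blast
qed

lemma section_faces_exposed_imp:
  assumes exposed: "faces_exposed S (E \<inter> S)"
  shows "faces_exposed UNIV E"
  unfolding faces_exposed_def
proof (intro allI impI, elim conjE)
  fix F assume F: "F face_of E" "F \<noteq> {}" "F \<noteq> E"
  obtain z where z: "z \<in> rel_interior F"
    using rel_interior_eq_empty[OF face_of_imp_convex[OF F(1)]] F(2) by blast
  obtain g where g: "g \<in> K" "g z \<in> S" using meets_orbits by blast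
  obtain h where h: "h \<in> K" "\<And>x. h (g x) = x" "\<And>x. g (h x) = x" "\<And>x y. g x \<bullet> y = x \<bullet> h y"
    by (rule inverse_K_apply[OF g(1)]) blast
  have lin: "linear g" by (rule bounded_linear.linear[OF blinfun.bounded_linear_right])
  have inj: "inj g" by (rule inj_on_inverseI[where g=h]) (simp add: h)
  have gE: "g ` E = E"
  proof
    show "g ` E \<subseteq> E" using invariantD[OF E(3) g(1)] by blast
    show "E \<subseteq> g ` E"
    proof
      fix x assume "x \<in> E"
      then have "h x \<in> E" by (rule invariantD[OF E(3) h(1)])
      then show "x \<in> g ` E" by (rule rev_image_eqI) (simp add: h(3))
    qed
  qed
  have "g ` F face_of E" using face_of_linear_image[OF lin inj, of F E] F(1) gE by simp
  moreover have "g ` F \<noteq> E" using F(3) gE inj by (metis inj_image_eq_iff)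
  moreover have "g z \<in> rel_interior (g ` F)"
    using rel_interior_injective_linear_image[of g F] lin inj z
    by (simp add: linear_conv_bounded_linear)
  ultimately obtain u where u: "u \<noteq> 0" "g ` F = exposed_face E u"
    using face_meeting_section_exposed[OF exposed _ _ _ g(2)] by blast
  have "F = exposed_face E (h u)"
  proof (rule Set.set_eqI)
    fix x
    have "x \<in> F \<longleftrightarrow> g x \<in> g ` F" using inj by (simp add: inj_image_mem_iff)
    also have "\<dots> \<longleftrightarrow> g x \<in> g ` E \<and> (\<forall>y\<in>g ` E. y \<bullet> u \<le> g x \<bullet> u)"
      unfolding u(2) exposed_face_def gE by simp
    also have "\<dots> \<longleftrightarrow> x \<in> exposed_face E (h u)"
      using inj by (simp add: inj_image_mem_iff h(4) exposed_face_def)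
    finally show "x \<in> F \<longleftrightarrow> x \<in> exposed_face E (h u)" .
  qed
  moreover have "h u \<noteq> 0" using u(1) h(3)[of u] by (metis blinfun.zero_right)
  ultimately show "\<exists>u\<in>UNIV. u \<noteq> 0 \<and> F = exposed_face E u" by blast
qed

end

end

section \<open>The theorem for fat sections\<close>

lemma tangent_space_subspace:
  assumes "subspace S"
  shows "tangent_space S p \<subseteq> S"
proof
  fix v assume v: "v \<in> tangent_space S p"
  obtain \<gamma> e where e: "e > (0::real)" and \<gamma>: "\<gamma> ` {-e<..<e} \<subseteq> S" "\<gamma> 0 = p"
    and d: "(\<gamma> has_vector_derivative v) (at 0)"
    using v unfolding tangent_space_def by blast
  have "v \<bullet> w = 0" if w: "w \<in> S\<^sup>\<bottom>" for w
  proof -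
    have der: "((\<lambda>t. w \<bullet> \<gamma> t) has_real_derivative w \<bullet> v) (at 0)"
      unfolding has_real_derivative_iff_has_vector_derivative
      by (rule bounded_linear.has_vector_derivative[OF bounded_linear_inner_right d])
    have zero: "w \<bullet> \<gamma> t = 0" if "\<bar>t\<bar> < e" for t
    proof -
      have "t \<in> {-e<..<e}" using that by auto
      then have "\<gamma> t \<in> S" using \<gamma>(1) by blast
      then show ?thesis using w by (auto simp: orthogonal_comp_def orthogonal_def inner_commute)
    qed
    have "w \<bullet> v = 0"
      using DERIV_local_const[OF der e] zero e by simp
    then show ?thesis by (simp add: inner_commute)
  qed
  then have "v \<in> S\<^sup>\<bottom>\<^sup>\<bottom>" by (auto simp: orthogonal_comp_def orthogonal_def inner_commute)
  then show "v \<in> S" using orthogonal_comp_self[OF assms] by simp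
qed

theorem theorem1p2:
  fixes G :: "('g, 'm) monoid_scheme"
    and T :: "'g topology"
    and A :: "('g set \<times> ('g \<Rightarrow> 'e::euclidean_space)) set"
    and \<rho> :: "'g \<Rightarrow> 'v::euclidean_space \<Rightarrow>\<^sub>L 'v"
    and S :: "'v set"
    and \<sigma> :: "'v \<Rightarrow> 'v"
    and E P :: "'v set"
  assumes "compact_lie_group G T A"
    and "orthogonal_representation G T \<rho>"
    and "nontrivial_copolarity G \<rho>"
    and "fat_section G \<rho> S"
    and "orthogonal_projection S \<sigma>"
    and "compact E" and "convex E" and "invariant_set G \<rho> E"
    and "P = \<sigma> ` E"
  shows "faces_exposed UNIV E \<longleftrightarrow> faces_exposed S P"
proof -
  define K where "K = \<rho> ` carrier G"
  have grp: "group G" and top: "topspace T = carrier G" and comp: "compact_space T"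
    using assms(1) by (auto simp: compact_lie_group_def lie_group_def topological_group_def)
  have hom: "\<rho> \<in> hom G orthogonal_group"
    and cont: "continuous_map T (top_of_set (carrier orthogonal_group)) \<rho>"
    using assms(2) by (auto simp: orthogonal_representation_def)
  have orth: "orthogonal_transformation (blinfun_apply (\<rho> g))" if "g \<in> carrier G" for g
    using hom that by (auto simp: hom_def orthogonal_group_def)
  have mult: "\<rho> (g \<otimes>\<^bsub>G\<^esub> h) = \<rho> g o\<^sub>L \<rho> h" if "g \<in> carrier G" "h \<in> carrier G" for g h
    using hom that by (auto simp: hom_def orthogonal_group_def)
  \<comment> \<open>A homomorphism in the sense of \<open>hom\<close> is only required to be multiplicative.\<close>
  have one: "\<rho> \<one>\<^bsub>G\<^esub> = id_blinfun"
  proof (rule blinfun_eqI)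
    fix x
    have c: "\<one>\<^bsub>G\<^esub> \<in> carrier G" using grp by (simp add: group.is_monoid)
    have "\<rho> \<one>\<^bsub>G\<^esub> (\<rho> \<one>\<^bsub>G\<^esub> x) = \<rho> \<one>\<^bsub>G\<^esub> x"
      using mult[OF c c] grp c by (metis blinfun_apply_blinfun_compose group.is_monoid monoid.l_one)
    then show "\<rho> \<one>\<^bsub>G\<^esub> x = id_blinfun x"
      using orthogonal_transformation_inj[OF orth[OF c]] by (simp add: inj_eq)
  qed
  have "compactin T (topspace T)" using comp by (simp add: compact_space_def)
  then have "compactin (top_of_set (carrier orthogonal_group)) (\<rho> ` topspace T)"
    using cont by (rule image_compactin)
  then have "compact K" by (simp add: K_def top compactin_subtopology)
  interpret K: compact_orthogonal_group K
  proof
    show "compact K" by fact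
    show "id_blinfun \<in> K"
      unfolding K_def using one grp by (metis group.is_monoid imageI monoid.one_closed)
    show "g o\<^sub>L h \<in> K" if gh: "g \<in> K" "h \<in> K" for g h
      using gh mult grp unfolding K_def by (auto simp: group.is_monoid monoid.m_closed simp flip: mult)
    show "\<exists>h\<in>K. h o\<^sub>L g = id_blinfun \<and> g o\<^sub>L h = id_blinfun" if g: "g \<in> K" for g
    proof -
      obtain a where a: "a \<in> carrier G" "g = \<rho> a" using g by (auto simp: K_def)
      have i: "inv\<^bsub>G\<^esub> a \<in> carrier G" using grp a(1) by simp
      have "\<rho> (inv\<^bsub>G\<^esub> a) o\<^sub>L g = id_blinfun" "g o\<^sub>L \<rho> (inv\<^bsub>G\<^esub> a) = id_blinfun"
        using mult[OF i a(1)] mult[OF a(1) i] grp a one by (simp_all add: group.l_inv group.r_inv)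
      then show ?thesis using i by (auto simp: K_def)
    qed
  qed (auto simp: K_def orth)
  have orbit: "rep_orbit G \<rho> x = K.orb x" for x
    unfolding orbit_def K.orb_def unfolding K_def by blast
  have regular: "regular_point G \<rho> p" if p: "K.principal p" for p
    unfolding regular_point_def
  proof (intro exI[of _ UNIV] conjI ballI)
    fix q
    obtain k where k: "k \<in> K" "K.isotropy p \<subseteq> K.isotropy (k q)"
      using K.principal_isotropy_fixes[OF p] by blast
    then obtain g where g: "g \<in> carrier G" "k = \<rho> g" by (auto simp: K_def)
    have "rep_stabilizer G \<rho> p \<subseteq> rep_stabilizer G \<rho> (\<rho> g q)"
    proof
      fix a assume "a \<in> rep_stabilizer G \<rho> p"
      then have a: "a \<in> carrier G" "\<rho> a p = p" by (auto simp: stabilizer_def)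
      then have "\<rho> a \<in> K.isotropy p" unfolding K.isotropy_def unfolding K_def by blast
      then have "\<rho> a \<in> K.isotropy (\<rho> g q)" using k(2) g(2) by blast
      then show "a \<in> rep_stabilizer G \<rho> (\<rho> g q)" using a(1) by (simp add: stabilizer_def K.isotropy_def)
    qed
    then show "\<exists>g\<in>carrier G. rep_stabilizer G \<rho> p \<subseteq> rep_stabilizer G \<rho> (\<rho> g q)"
      using g(1) by blast
  qed auto
  have S: "subspace S" using assms(4) by (simp add: fat_section_def)
  interpret S: normal_section K S
  proof
    show "subspace S" by fact
    show "\<exists>g\<in>K. g x \<in> S" for x
    proof -
      have "rep_orbit G \<rho> x \<inter> S \<noteq> {}" using assms(4) by (simp add: fat_section_def)
      then show ?thesis unfolding orbit K.orb_def by blast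
    qed
    show "normal_space (K.orb p) p \<subseteq> S" if p: "p \<in> S" "K.principal p" for p
    proof -
      have "normal_space (rep_orbit G \<rho> p) p \<subseteq> tangent_space S p"
        using assms(4) p(1) regular[OF p(2)] unfolding fat_section_def by blast
      then show ?thesis using tangent_space_subspace[OF S] unfolding orbit by blast
    qed
  qed
  have inv: "K.invariant E"
    using assms(8) unfolding invariant_set_def K.invariant_def unfolding K_def by blast
  note projection_and_E = assms(5,6,7) inv
  have "P = E \<inter> S" using S.projection_eq_section[OF projection_and_E] assms(9) by simp
  then show ?thesis
    using S.faces_exposed_imp_section[OF projection_and_E] S.section_faces_exposed_imp[OF projection_and_E] by blast
qed

end
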